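(* The synthesis problem for flat global window $L$-PCTL formulae is $\Sigma_1^1$-hard: deciding, given a finite MDP $M$ and a global window formula $\forall G\,\Phi$ with $\Phi$ flat, whether there exists a strategy $\sigma$ with $M[\sigma]\models\forall G\,\Phi$, is $\Sigma_1^1$-hard.
   Context: A Markov chain (MC) is a tuple $(S,s_{\mathrm{init}},P,AP,L)$ with $S$ a countable set of states, $s_{\mathrm{init}}\in S$, $P:S\to\mathrm{Dist}(S)$, $AP$ a nonempty finite set of atomic propositions, $L:S\to 2^{AP}$; it induces the standard probability measure $\mu$ on infinite paths from each state. A Markov decision process (MDP) is $M=(S,A,s_{\mathrm{init}},P,AP,L)$ with $S$ finite, $A$ a finite set of actions, $P:S\times A\to\mathrm{Dist}(S)$ with rational probabilities in binary (every action available in every state). A finite path is $s_0a_0s_1\cdots s_i$ with $P(s_j,a_j,s_{j+1})>0$. A strategy $\sigma$ maps finite paths to distributions over $A$ (randomisation and unbounded memory allowed). $M[\sigma]$ is the MC whose states are finite paths of $M$, initial state $s_{\mathrm{init}}$, transitions $\rho\to\rho a s$ with probability $\sigma(\rho)(a)P(\mathrm{last}(\rho),a,s)$, labels $L(\mathrm{last}(\rho))$. $L$-PCTL: state formulae $\Phi::=p\mid\neg p\mid\Phi_1\wedge\Phi_2\mid\Phi_1\vee\Phi_2\mid\sum_{i=1}^n c_i\mathbb P(\varphi_i)\succcurlyeq c_0$ with $p\in AP$, $n\ge1$, $c_i\in\mathbb Z$, ${\succcurlyeq}\in\{\ge,>\}$; path formulae $\varphi::=X^\ell\Phi\mid\Phi_1U^\ell\Phi_2\mid\Phi_1W^\ell\Phi_2\mid\Phi_1U^\infty\Phi_2\mid\Phi_1W^\infty\Phi_2$,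 $\ell\in\mathbb N$. An infinite path $s_0s_1\cdots$ satisfies $X^\ell\Phi$ iff $s_\ell\models\Phi$; $\Phi_1U^\ell\Phi_2$ iff some $j\le\ell$ has $s_j\models\Phi_2$ and $s_i\models\Phi_1$ for all $i<j$; $\Phi_1W^\ell\Phi_2$ iff for every $j\le\ell$, $s_j\models\Phi_1$ or $s_j\models\Phi_2$ or some $i<j$ has $s_i\models\Phi_2$; $\infty$ versions let $j$ range over $\mathbb N$. A state $s$ satisfies $\sum c_i\mathbb P(\varphi_i)\succcurlyeq c_0$ iff $\sum c_i\,\mu(\{\text{paths from } s\text{ satisfying }\varphi_i\})\succcurlyeq c_0$; atomic and Boolean cases as usual. $\Phi$ is a window formula if all horizon labels are finite; flat if no $\mathbb P$ operator occurs inside the argument of another $\mathbb P$ operator (strict comparisons $>$ are allowed). A global window formula is $\forall G\,\Phi$ with $\Phi$ a window formula; a state satisfies it iff every state reachable from it satisfies $\Phi$; an MC satisfies it if its initial state does. *)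

theory Defs
  imports "HOL-Probability.Probability" "HOL-Library.Nat_Bijection" "HOL-Library.Extended_Nat"
begin

section \<open>Markov chains\<close>

record ('s, 'p) mc =
  mc_states :: "'s set"
  mc_init :: 's
  mc_trans :: "'s \<Rightarrow> 's pmf"
  mc_AP :: "'p set"
  mc_label :: "'s \<Rightarrow> 'p set"

definition is_mc :: "('s, 'p) mc \<Rightarrow> bool" where
  "is_mc C \<longleftrightarrow>
     countable (mc_states C) \<and> mc_init C \<in> mc_states C \<and>
     (\<forall>s\<in>mc_states C. set_pmf (mc_trans C s) \<subseteq> mc_states C) \<and>
     finite (mc_AP C) \<and> mc_AP C \<noteq> {} \<and>
     (\<forall>s\<in>mc_states C. mc_label C s \<subseteq> mc_AP C)"

definition step_kernel :: "('s \<Rightarrow> 's pmf) \<Rightarrow> 's \<Rightarrow> nat \<Rightarrow> (nat \<Rightarrow> 's) \<Rightarrow> 's measure" where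
  "step_kernel K s i \<omega> = measure_pmf (case i of 0 \<Rightarrow> return_pmf s | Suc j \<Rightarrow> K (\<omega> j))"

text \<open>The measure on infinite paths from \<open>s\<close>, obtained from the Ionescu-Tulcea theorem; it is a
  measure on the product sigma-algebra of the discrete space of states, and
  \<open>measure_path_measure_cylinder\<close> below gives its values on cylinders.\<close>

definition path_measure :: "('s \<Rightarrow> 's pmf) \<Rightarrow> 's \<Rightarrow> (nat \<Rightarrow> 's) measure" where
  "path_measure K s =
     projective_family.lim UNIV
       (Ionescu_Tulcea.CI (step_kernel K s) (\<lambda>_. count_space UNIV)) (\<lambda>_. count_space UNIV)"

definition mc_reachable :: "('s, 'p) mc \<Rightarrow> 's \<Rightarrow> 's set" where
  "mc_reachable C s = {t. (s, t) \<in> {(u, v). v \<in> set_pmf (mc_trans C u)}\<^sup>*}"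

lemma Ionescu_Tulcea_step_kernel:
  "Ionescu_Tulcea (step_kernel K s) (\<lambda>_. count_space UNIV)"
proof (rule Ionescu_Tulcea.intro)
  fix i
  show "step_kernel K s i \<in>
      measurable (PiM {0..<i} (\<lambda>_. count_space UNIV)) (subprob_algebra (count_space UNIV))"
  proof (cases i)
    case 0
    then show ?thesis
      by (auto simp: step_kernel_def[abs_def] measure_pmf_in_subprob_algebra)
  next
    case (Suc j)
    have "(\<lambda>\<omega>. \<omega> j) \<in> measurable (PiM {0..<i} (\<lambda>_. count_space (UNIV::'a set))) (count_space UNIV)"
      by (rule measurable_component_singleton) (simp add: Suc)
    moreover have "(\<lambda>x. measure_pmf (K x)) \<in> measurable (count_space UNIV) (subprob_algebra (count_space UNIV))"
      by (auto simp: measure_pmf_in_subprob_algebra)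
    ultimately show ?thesis
      unfolding step_kernel_def[abs_def] Suc nat.case by (rule measurable_compose)
  qed
next
  fix i x
  show "prob_space (step_kernel K s i x)"
    by (simp add: step_kernel_def measure_pmf.prob_space_axioms)
qed

lemma sets_path_measure:
  "sets (path_measure K s) = sets (PiM UNIV (\<lambda>_. count_space UNIV))"
proof -
  interpret Ionescu_Tulcea "step_kernel K s" "\<lambda>_. count_space UNIV"
    by (rule Ionescu_Tulcea_step_kernel)
  show ?thesis
    unfolding path_measure_def by (rule PF.sets_lim)
qed

lemma space_path_measure: "space (path_measure K s) = UNIV"
  using sets_eq_imp_space_eq[OF sets_path_measure[of K s]] by (simp add: space_PiM PiE_def)

lemma emeasure_step_C:
  fixes K :: "'s \<Rightarrow> 's pmf"
  shows "emeasure (Ionescu_Tulcea.C (step_kernel K s) (\<lambda>_. count_space UNIV) 0 (Suc n) (\<lambda>_. undefined))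
       {restrict x {0..<Suc n}} =
     ennreal (if x 0 = s then \<Prod>i<n. pmf (K (x i)) (x (Suc i)) else 0)"
proof -
  interpret Ionescu_Tulcea "step_kernel K s" "\<lambda>_. count_space UNIV"
    by (rule Ionescu_Tulcea_step_kernel)
  let ?u = "\<lambda>_::nat. undefined :: 's"
  let ?r = "\<lambda>n. restrict x {0..<n}"
  have sp[simp]: "\<omega> \<in> space (PiM {0..<n} (\<lambda>_. count_space (UNIV::'s set))) \<longleftrightarrow> \<omega> \<in> extensional {0..<n}" for n \<omega>
    by (auto simp: space_PiM PiE_def)
  have sgl: "{?r n} \<in> sets (PiM {0..<n} (\<lambda>_. count_space (UNIV::'s set)))" for n
  proof -
    have "{?r n} = PiE {0..<n} (\<lambda>i. {x i})"
      by (auto simp: PiE_def Pi_iff extensional_def fun_eq_iff restrict_def)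
    then show ?thesis by (simp add: sets_PiM_I_finite)
  qed
  have step: "emeasure (C 0 (Suc n) ?u) {?r (Suc n)} =
      emeasure (C 0 n ?u) {?r n} * emeasure (step_kernel K s n (?r n)) {x n}" for n
  proof -
    have "emeasure (C 0 (Suc n) ?u) {?r (Suc n)} = (\<integral>\<^sup>+\<omega>. emeasure (eP n \<omega>) {?r (Suc n)} \<partial>C 0 n ?u)"
      using sgl[of "Suc n"]
      by (simp, subst emeasure_bind[where N="PiM {0..<Suc n} (\<lambda>_. count_space UNIV)"])
         (auto simp: space_C extensional_def measurable_cong_sets[OF sets_C] intro!: measurable_eP)
    also have "\<dots> = (\<integral>\<^sup>+\<omega>. emeasure (step_kernel K s n (?r n)) {x n} * indicator {?r n} \<omega> \<partial>C 0 n ?u)"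
    proof (rule nn_integral_cong)
      fix \<omega> assume "\<omega> \<in> space (C 0 n ?u)"
      then have w: "\<omega> \<in> extensional {0..<n}"
        using space_C[of ?u 0 n] by (auto simp: extensional_def)
      have eq: "fun_upd \<omega> n -` {?r (Suc n)} = (if \<omega> = ?r n then {x n} else {})"
      proof -
        have "fun_upd \<omega> n y = ?r (Suc n) \<longleftrightarrow> \<omega> = ?r n \<and> y = x n" for y
        proof
          assume *: "fun_upd \<omega> n y = ?r (Suc n)"
          have "\<omega> i = ?r n i" for i
            using fun_cong[OF *, of i] extensional_arb[OF w, of i] by (cases "i < n") auto
          moreover have "y = x n"
            using fun_cong[OF *, of n] by simp
          ultimately show "\<omega> = ?r n \<and> y = x n" by auto
        qed (auto simp: fun_eq_iff)
        then show ?thesis by auto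
      qed
      have "emeasure (eP n \<omega>) {?r (Suc n)} =
          emeasure (step_kernel K s n \<omega>) (fun_upd \<omega> n -` {?r (Suc n)})"
        using emeasure_eP[of \<omega> n "{?r (Suc n)}"] sgl[of "Suc n"] w by simp
      then show "emeasure (eP n \<omega>) {?r (Suc n)} = emeasure (step_kernel K s n (?r n)) {x n} * indicator {?r n} \<omega>"
        unfolding eq by (auto split: split_indicator)
    qed
    also have "\<dots> = emeasure (C 0 n ?u) {?r n} * emeasure (step_kernel K s n (?r n)) {x n}"
      using sgl[of n] by (subst nn_integral_cmult_indicator) (auto simp: sets_C extensional_def mult.commute)
    finally show ?thesis .
  qed
  show ?thesis
  proof (induction n)
    case 0
    have "emeasure (C 0 0 ?u) {?r 0} = 1"
      using sgl[of 0] by (simp add: emeasure_return restrict_def)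
    then show ?case
      by (subst step) (auto simp: step_kernel_def emeasure_pmf_single)
  next
    case (Suc n)
    show ?case
      by (subst step, subst Suc)
         (auto simp: step_kernel_def emeasure_pmf_single ennreal_mult prod_nonneg)
  qed
qed

lemma measure_path_measure_cylinder:
  "measure (path_measure K s) {\<omega>. \<forall>i\<le>n. \<omega> i = x i} =
     (if x 0 = s then \<Prod>i<n. pmf (K (x i)) (x (Suc i)) else 0)"
proof -
  interpret Ionescu_Tulcea "step_kernel K s" "\<lambda>_. count_space UNIV"
    by (rule Ionescu_Tulcea_step_kernel)
  let ?J = "{0..<Suc n}" and ?r = "restrict x {0..<Suc n}"
  have "{?r} = PiE ?J (\<lambda>i. {x i})"
    by (auto simp: PiE_def Pi_iff extensional_def fun_eq_iff restrict_def)
  then have sgl: "{?r} \<in> sets (PiM ?J (\<lambda>_. count_space UNIV))"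
    by (simp add: sets_PiM_I_finite)
  have cyl: "{\<omega>. \<forall>i\<le>n. \<omega> i = x i} = PF.emb UNIV ?J {?r}"
  proof -
    have "restrict \<omega> ?J = ?r \<longleftrightarrow> (\<forall>i\<le>n. \<omega> i = x i)" for \<omega>
      by (metis atLeastLessThan_iff le0 less_Suc_eq_le restrict_apply' restrict_ext)
    then show ?thesis by (auto simp: prod_emb_def space_PiM PiE_def)
  qed
  have "emeasure (path_measure K s) {\<omega>. \<forall>i\<le>n. \<omega> i = x i} = emeasure (CI ?J) {?r}"
    unfolding path_measure_def cyl by (rule lim) (use sgl in auto)
  also have "\<dots> = emeasure (C 0 (Suc n) (\<lambda>_. undefined)) {?r}"
  proof -
    have "prod_emb ?J (\<lambda>_. count_space UNIV) ?J {?r} = {?r}"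
      using sets.sets_into_space[OF sgl] by (intro prod_emb_id) (simp add: space_PiM)
    then show ?thesis
      using sgl by (subst emeasure_CI[where n="Suc n"]) (auto simp del: C.simps)
  qed
  also note emeasure_step_C
  finally show ?thesis
    by (simp add: measure_def prod_nonneg)
qed

section \<open>L-PCTL\<close>

datatype comparison = GEq | Gr

primrec cmp_holds :: "comparison \<Rightarrow> real \<Rightarrow> real \<Rightarrow> bool" where
  "cmp_holds GEq x y \<longleftrightarrow> x \<ge> y"
| "cmp_holds Gr x y \<longleftrightarrow> x > y"

text \<open>\<open>PSum [(c\<^sub>1, \<phi>\<^sub>1), \<dots>, (c\<^sub>n, \<phi>\<^sub>n)] cmp c\<^sub>0\<close> is the linear constraint comparing
  the sum of the \<open>c\<^sub>i P(\<phi>\<^sub>i)\<close> with \<open>c\<^sub>0\<close>; the condition \<open>n \<ge> 1\<close> is part of \<open>wf_sform\<close>.\<close>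

datatype 'p sform =
    Atom 'p
  | NegAtom 'p
  | Conj "'p sform" "'p sform"
  | Disj "'p sform" "'p sform"
  | PSum "(int \<times> 'p pform) list" comparison int
and 'p pform =
    Next nat "'p sform"
  | Until enat "'p sform" "'p sform"
  | WUntil enat "'p sform" "'p sform"

fun wf_sform :: "'p set \<Rightarrow> 'p sform \<Rightarrow> bool" and wf_pform :: "'p set \<Rightarrow> 'p pform \<Rightarrow> bool" where
  "wf_sform AP (Atom p) \<longleftrightarrow> p \<in> AP"
| "wf_sform AP (NegAtom p) \<longleftrightarrow> p \<in> AP"
| "wf_sform AP (Conj \<Phi> \<Psi>) \<longleftrightarrow> wf_sform AP \<Phi> \<and> wf_sform AP \<Psi>"
| "wf_sform AP (Disj \<Phi> \<Psi>) \<longleftrightarrow> wf_sform AP \<Phi> \<and> wf_sform AP \<Psi>"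
| "wf_sform AP (PSum ts cmp c0) \<longleftrightarrow> ts \<noteq> [] \<and> (\<forall>(c, \<phi>)\<in>set ts. wf_pform AP \<phi>)"
| "wf_pform AP (Next l \<Phi>) \<longleftrightarrow> wf_sform AP \<Phi>"
| "wf_pform AP (Until h \<Phi> \<Psi>) \<longleftrightarrow> wf_sform AP \<Phi> \<and> wf_sform AP \<Psi>"
| "wf_pform AP (WUntil h \<Phi> \<Psi>) \<longleftrightarrow> wf_sform AP \<Phi> \<and> wf_sform AP \<Psi>"

fun sat :: "('s, 'p) mc \<Rightarrow> 's \<Rightarrow> 'p sform \<Rightarrow> bool"
  and path_sat :: "('s, 'p) mc \<Rightarrow> (nat \<Rightarrow> 's) \<Rightarrow> 'p pform \<Rightarrow> bool" where
  "sat C s (Atom p) \<longleftrightarrow> p \<in> mc_label C s"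
| "sat C s (NegAtom p) \<longleftrightarrow> p \<notin> mc_label C s"
| "sat C s (Conj \<Phi> \<Psi>) \<longleftrightarrow> sat C s \<Phi> \<and> sat C s \<Psi>"
| "sat C s (Disj \<Phi> \<Psi>) \<longleftrightarrow> sat C s \<Phi> \<or> sat C s \<Psi>"
| "sat C s (PSum ts cmp c0) \<longleftrightarrow>
     cmp_holds cmp
       (\<Sum>(c, \<phi>)\<leftarrow>ts. real_of_int c * measure (path_measure (mc_trans C) s) {\<omega>. path_sat C \<omega> \<phi>})
       (real_of_int c0)"
| "path_sat C \<omega> (Next l \<Phi>) \<longleftrightarrow> sat C (\<omega> l) \<Phi>"
| "path_sat C \<omega> (Until h \<Phi> \<Psi>) \<longleftrightarrow>
     (\<exists>j. enat j \<le> h \<and> sat C (\<omega> j) \<Psi> \<and> (\<forall>i<j. sat C (\<omega> i) \<Phi>))"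
| "path_sat C \<omega> (WUntil h \<Phi> \<Psi>) \<longleftrightarrow>
     (\<forall>j. enat j \<le> h \<longrightarrow> sat C (\<omega> j) \<Phi> \<or> sat C (\<omega> j) \<Psi> \<or> (\<exists>i<j. sat C (\<omega> i) \<Psi>))"

fun window :: "'p sform \<Rightarrow> bool" and window_path :: "'p pform \<Rightarrow> bool" where
  "window (Atom p) \<longleftrightarrow> True"
| "window (NegAtom p) \<longleftrightarrow> True"
| "window (Conj \<Phi> \<Psi>) \<longleftrightarrow> window \<Phi> \<and> window \<Psi>"
| "window (Disj \<Phi> \<Psi>) \<longleftrightarrow> window \<Phi> \<and> window \<Psi>"
| "window (PSum ts cmp c0) \<longleftrightarrow> (\<forall>(c, \<phi>)\<in>set ts. window_path \<phi>)"
| "window_path (Next l \<Phi>) \<longleftrightarrow> window \<Phi>"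
| "window_path (Until h \<Phi> \<Psi>) \<longleftrightarrow> h \<noteq> \<infinity> \<and> window \<Phi> \<and> window \<Psi>"
| "window_path (WUntil h \<Phi> \<Psi>) \<longleftrightarrow> h \<noteq> \<infinity> \<and> window \<Phi> \<and> window \<Psi>"

primrec prob_free :: "'p sform \<Rightarrow> bool" where
  "prob_free (Atom p) \<longleftrightarrow> True"
| "prob_free (NegAtom p) \<longleftrightarrow> True"
| "prob_free (Conj \<Phi> \<Psi>) \<longleftrightarrow> prob_free \<Phi> \<and> prob_free \<Psi>"
| "prob_free (Disj \<Phi> \<Psi>) \<longleftrightarrow> prob_free \<Phi> \<and> prob_free \<Psi>"
| "prob_free (PSum ts cmp c0) \<longleftrightarrow> False"

primrec prob_free_path :: "'p pform \<Rightarrow> bool" where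
  "prob_free_path (Next l \<Phi>) \<longleftrightarrow> prob_free \<Phi>"
| "prob_free_path (Until h \<Phi> \<Psi>) \<longleftrightarrow> prob_free \<Phi> \<and> prob_free \<Psi>"
| "prob_free_path (WUntil h \<Phi> \<Psi>) \<longleftrightarrow> prob_free \<Phi> \<and> prob_free \<Psi>"

primrec flat :: "'p sform \<Rightarrow> bool" where
  "flat (Atom p) \<longleftrightarrow> True"
| "flat (NegAtom p) \<longleftrightarrow> True"
| "flat (Conj \<Phi> \<Psi>) \<longleftrightarrow> flat \<Phi> \<and> flat \<Psi>"
| "flat (Disj \<Phi> \<Psi>) \<longleftrightarrow> flat \<Phi> \<and> flat \<Psi>"
| "flat (PSum ts cmp c0) \<longleftrightarrow> (\<forall>(c, \<phi>)\<in>set ts. prob_free_path \<phi>)"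

definition sat_AG :: "('s, 'p) mc \<Rightarrow> 's \<Rightarrow> 'p sform \<Rightarrow> bool" where
  "sat_AG C s \<Phi> \<longleftrightarrow> (\<forall>t\<in>mc_reachable C s. sat C t \<Phi>)"

definition mc_sat_AG :: "('s, 'p) mc \<Rightarrow> 'p sform \<Rightarrow> bool" where
  "mc_sat_AG C \<Phi> \<longleftrightarrow> sat_AG C (mc_init C) \<Phi>"

section \<open>Markov decision processes\<close>

record ('s, 'a, 'p) mdp =
  mdp_states :: "'s set"
  mdp_actions :: "'a set"
  mdp_init :: 's
  mdp_trans :: "'s \<Rightarrow> 'a \<Rightarrow> 's pmf"
  mdp_AP :: "'p set"
  mdp_label :: "'s \<Rightarrow> 'p set"

definition is_mdp :: "('s, 'a, 'p) mdp \<Rightarrow> bool" where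
  "is_mdp M \<longleftrightarrow>
     finite (mdp_states M) \<and> finite (mdp_actions M) \<and> mdp_init M \<in> mdp_states M \<and>
     (\<forall>s\<in>mdp_states M. \<forall>a\<in>mdp_actions M.
        set_pmf (mdp_trans M s a) \<subseteq> mdp_states M \<and> (\<forall>t. pmf (mdp_trans M s a) t \<in> \<rat>)) \<and>
     finite (mdp_AP M) \<and> mdp_AP M \<noteq> {} \<and>
     (\<forall>s\<in>mdp_states M. mdp_label M s \<subseteq> mdp_AP M)"

datatype ('s, 'a) fpath = Start 's | Step "('s, 'a) fpath" 'a 's

primrec last_state :: "('s, 'a) fpath \<Rightarrow> 's" where
  "last_state (Start s) = s"
| "last_state (Step \<rho> a s) = s"

primrec is_fpath :: "('s, 'a, 'p) mdp \<Rightarrow> ('s, 'a) fpath \<Rightarrow> bool" where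
  "is_fpath M (Start s) \<longleftrightarrow> s \<in> mdp_states M"
| "is_fpath M (Step \<rho> a s) \<longleftrightarrow>
     is_fpath M \<rho> \<and> a \<in> mdp_actions M \<and> s \<in> mdp_states M \<and> pmf (mdp_trans M (last_state \<rho>) a) s > 0"

definition is_strategy :: "('s, 'a, 'p) mdp \<Rightarrow> (('s, 'a) fpath \<Rightarrow> 'a pmf) \<Rightarrow> bool" where
  "is_strategy M \<sigma> \<longleftrightarrow> (\<forall>\<rho>. is_fpath M \<rho> \<longrightarrow> set_pmf (\<sigma> \<rho>) \<subseteq> mdp_actions M)"

definition induced_mc ::
    "('s, 'a, 'p) mdp \<Rightarrow> (('s, 'a) fpath \<Rightarrow> 'a pmf) \<Rightarrow> (('s, 'a) fpath, 'p) mc" where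
  "induced_mc M \<sigma> =
     \<lparr> mc_states = {\<rho>. is_fpath M \<rho>},
       mc_init = Start (mdp_init M),
       mc_trans = (\<lambda>\<rho>. bind_pmf (\<sigma> \<rho>) (\<lambda>a. map_pmf (Step \<rho> a) (mdp_trans M (last_state \<rho>) a))),
       mc_AP = mdp_AP M,
       mc_label = (\<lambda>\<rho>. mdp_label M (last_state \<rho>)) \<rparr>"

lemma pmf_induced_mc_Step:
  "pmf (mc_trans (induced_mc M \<sigma>) \<rho>) (Step \<rho> a s) = pmf (\<sigma> \<rho>) a * pmf (mdp_trans M (last_state \<rho>) a) s"
proof -
  have "pmf (map_pmf (Step \<rho> b) (mdp_trans M (last_state \<rho>) b)) (Step \<rho> a s) =
      pmf (mdp_trans M (last_state \<rho>) a) s * indicator {a} b" for b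
  proof (cases "b = a")
    case True
    have "inj (Step \<rho> a)" by (auto simp: inj_def)
    with True show ?thesis by (simp add: pmf_map_inj')
  next
    case False
    then have "Step \<rho> a s \<notin> set_pmf (map_pmf (Step \<rho> b) (mdp_trans M (last_state \<rho>) b))" by auto
    then have "pmf (map_pmf (Step \<rho> b) (mdp_trans M (last_state \<rho>) b)) (Step \<rho> a s) = 0"
      by (simp only: set_pmf_iff not_not)
    with False show ?thesis by simp
  qed
  then show ?thesis
    by (simp add: induced_mc_def pmf_bind pmf.rep_eq[symmetric] mult.commute)
       (simp add: pmf.rep_eq)
qed

lemma is_mc_induced_mc:
  assumes "is_mdp M" "is_strategy M \<sigma>"
  shows "is_mc (induced_mc M \<sigma>)"
proof -
  have cnt: "countable {\<rho>. is_fpath M \<rho>}"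
  proof -
    define f :: "('a, 'b) fpath \<Rightarrow> 'a \<times> ('b \<times> 'a) list" where
      "f = rec_fpath (\<lambda>s. (s, [])) (\<lambda>\<rho> a s r. (fst r, (a, s) # snd r))"
    have fs: "f (Start s) = (s, [])" "f (Step \<rho> a s) = (fst (f \<rho>), (a, s) # snd (f \<rho>))" for s \<rho> a
      by (simp_all add: f_def)
    have "\<rho> = \<rho>'" if "f \<rho> = f \<rho>'" for \<rho> \<rho>'
      using that
    proof (induction \<rho> arbitrary: \<rho>')
      case (Start s) then show ?case by (cases \<rho>') (auto simp: fs)
    next
      case (Step \<rho> a s) then show ?case by (cases \<rho>') (auto simp: fs prod_eq_iff)
    qed
    then have inj: "inj_on f {\<rho>. is_fpath M \<rho>}" by (auto intro: inj_onI)
    have "f \<rho> \<in> mdp_states M \<times> lists (mdp_actions M \<times> mdp_states M)" if "is_fpath M \<rho>" for \<rho>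
      using that by (induction \<rho>) (auto simp: fs mem_Times_iff)
    then have "f ` {\<rho>. is_fpath M \<rho>} \<subseteq> mdp_states M \<times> lists (mdp_actions M \<times> mdp_states M)" by blast
    moreover have "countable (mdp_states M \<times> lists (mdp_actions M \<times> mdp_states M))"
      using assms(1) by (auto simp: is_mdp_def countable_finite)
    ultimately show ?thesis
      using inj countable_subset countable_image_inj_on by blast
  qed
  have last: "last_state \<rho> \<in> mdp_states M" if "is_fpath M \<rho>" for \<rho>
    using that by (cases \<rho>) auto
  show ?thesis
    using assms cnt last
    by (auto simp: is_mc_def induced_mc_def is_mdp_def is_strategy_def pmf_positive_iff) blast+
qed

section \<open>The synthesis problem as a set of natural numbers\<close>

text \<open>Every finite MDP is isomorphic to one whose states, actions and atomic propositions form
  initial segments of the natural numbers; these are the MDPs given as input.\<close>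

definition input_mdp :: "(nat, nat, nat) mdp \<Rightarrow> bool" where
  "input_mdp M \<longleftrightarrow> is_mdp M \<and>
     (\<exists>n. mdp_states M = {..<n}) \<and> (\<exists>m. mdp_actions M = {..<m}) \<and> (\<exists>k. mdp_AP M = {..<k})"

definition encode_rational :: "real \<Rightarrow> nat" where
  "encode_rational x =
     (case quotient_of (the_inv real_of_rat x) of (p, q) \<Rightarrow> prod_encode (int_encode p, int_encode q))"

definition encode_mdp :: "(nat, nat, nat) mdp \<Rightarrow> nat" where
  "encode_mdp M = list_encode
     [card (mdp_states M), card (mdp_actions M), mdp_init M,
      list_encode (map (\<lambda>s. list_encode (map (\<lambda>a. list_encode (map (\<lambda>t.
          encode_rational (pmf (mdp_trans M s a) t))
        [0..<card (mdp_states M)])) [0..<card (mdp_actions M)])) [0..<card (mdp_states M)]),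
      card (mdp_AP M),
      list_encode (map (\<lambda>s. set_encode (mdp_label M s)) [0..<card (mdp_states M)])]"

primrec encode_comparison :: "comparison \<Rightarrow> nat" where
  "encode_comparison GEq = 0"
| "encode_comparison Gr = 1"

definition encode_horizon :: "enat \<Rightarrow> nat" where
  "encode_horizon h = (case h of enat l \<Rightarrow> Suc l | \<infinity> \<Rightarrow> 0)"

fun encode_sform :: "nat sform \<Rightarrow> nat" and encode_pform :: "nat pform \<Rightarrow> nat" where
  "encode_sform (Atom p) = list_encode [0, p]"
| "encode_sform (NegAtom p) = list_encode [1, p]"
| "encode_sform (Conj \<Phi> \<Psi>) = list_encode [2, encode_sform \<Phi>, encode_sform \<Psi>]"
| "encode_sform (Disj \<Phi> \<Psi>) = list_encode [3, encode_sform \<Phi>, encode_sform \<Psi>]"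
| "encode_sform (PSum ts cmp c0) = list_encode
     [4, list_encode (map (\<lambda>(c, \<phi>). prod_encode (int_encode c, encode_pform \<phi>)) ts),
      encode_comparison cmp, int_encode c0]"
| "encode_pform (Next l \<Phi>) = list_encode [0, l, encode_sform \<Phi>]"
| "encode_pform (Until h \<Phi> \<Psi>) =
     list_encode [1, encode_horizon h, encode_sform \<Phi>, encode_sform \<Psi>]"
| "encode_pform (WUntil h \<Phi> \<Psi>) =
     list_encode [2, encode_horizon h, encode_sform \<Phi>, encode_sform \<Psi>]"

definition encode_instance :: "(nat, nat, nat) mdp \<Rightarrow> nat sform \<Rightarrow> nat" where
  "encode_instance M \<Phi> = prod_encode (encode_mdp M, encode_sform \<Phi>)"

lemma encode_comparison_inj: "encode_comparison a = encode_comparison b \<Longrightarrow> a = b"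
  by (cases a; cases b) auto

lemma encode_horizon_inj: "encode_horizon a = encode_horizon b \<Longrightarrow> a = b"
  by (auto simp: encode_horizon_def split: enat.splits)

lemma encode_sform_inj: "encode_sform \<Phi> = encode_sform \<Psi> \<Longrightarrow> \<Phi> = \<Psi>"
  and encode_pform_inj: "encode_pform \<phi> = encode_pform \<psi> \<Longrightarrow> \<phi> = \<psi>"
proof (induction \<Phi> and \<phi> arbitrary: \<Psi> and \<psi> rule: encode_sform_encode_pform.induct)
  case (1 p) then show ?case by (cases \<Psi>) (auto simp: list_encode_eq int_encode_eq simp del: list_encode.simps)
next
  case (2 p) then show ?case by (cases \<Psi>) (auto simp: list_encode_eq int_encode_eq simp del: list_encode.simps)
next
  case (3 \<Phi>1 \<Phi>2) then show ?case by (cases \<Psi>) (auto simp: list_encode_eq int_encode_eq simp del: list_encode.simps)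
next
  case (4 \<Phi>1 \<Phi>2) then show ?case by (cases \<Psi>) (auto simp: list_encode_eq int_encode_eq simp del: list_encode.simps)
next
  case (5 ts cmp c0)
  from "5.prems" obtain us where \<Psi>: "\<Psi> = PSum us cmp c0" and
    eq: "map (\<lambda>(c, \<phi>). prod_encode (int_encode c, encode_pform \<phi>)) ts =
         map (\<lambda>(c, \<phi>). prod_encode (int_encode c, encode_pform \<phi>)) us"
    by (cases \<Psi>) (auto simp: list_encode_eq int_encode_eq simp del: list_encode.simps dest: encode_comparison_inj)
  have len: "length ts = length us"
    using eq by (metis length_map)
  have "ts ! i = us ! i" if i: "i < length ts" for i
  proof -
    have "prod_encode (int_encode (fst (ts ! i)), encode_pform (snd (ts ! i))) =
        prod_encode (int_encode (fst (us ! i)), encode_pform (snd (us ! i)))"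
      using arg_cong[OF eq, of "\<lambda>l. l ! i"] i len by (simp add: case_prod_beta)
    then show ?thesis
      using "5.IH"[of "ts ! i" "fst (ts ! i)" "snd (ts ! i)"] i by (auto simp: prod_eq_iff int_encode_eq)
  qed
  with len have "ts = us" by (auto intro: nth_equalityI)
  with \<Psi> show ?case by simp
next
  case (6 l \<Phi>) then show ?case by (cases \<psi>) (auto simp: list_encode_eq int_encode_eq simp del: list_encode.simps)
next
  case (7 h \<Phi>1 \<Phi>2)
  then show ?case by (cases \<psi>) (auto simp: list_encode_eq int_encode_eq simp del: list_encode.simps dest: encode_horizon_inj)
next
  case (8 h \<Phi>1 \<Phi>2)
  then show ?case by (cases \<psi>) (auto simp: list_encode_eq int_encode_eq simp del: list_encode.simps dest: encode_horizon_inj)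
qed

lemma encode_rational_inj:
  assumes "x \<in> \<rat>" "y \<in> \<rat>" "encode_rational x = encode_rational y"
  shows "x = y"
proof -
  obtain q r where [simp]: "x = real_of_rat q" "y = real_of_rat r"
    using assms(1,2) by (auto elim!: Rats_cases)
  have [simp]: "the_inv real_of_rat (real_of_rat q) = q" for q
    by (rule the_inv_f_f) (auto simp: inj_def)
  have "quotient_of q = quotient_of r"
    using assms(3) by (auto simp: encode_rational_def int_encode_eq split: prod.splits)
  then show ?thesis by (simp add: quotient_of_inject_eq)
qed

text \<open>An input MDP is determined by its code, up to the irrelevant values of its transition and
  labelling functions outside the sets of states and actions.\<close>

lemma encode_mdp_inj:
  assumes M: "input_mdp M" and N: "input_mdp N" and eq: "encode_mdp M = encode_mdp N"
  shows "mdp_states M = mdp_states N" "mdp_actions M = mdp_actions N" "mdp_init M = mdp_init N"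
    and "mdp_AP M = mdp_AP N"
    and "\<And>s a. s \<in> mdp_states M \<Longrightarrow> a \<in> mdp_actions M \<Longrightarrow> mdp_trans M s a = mdp_trans N s a"
    and "\<And>s. s \<in> mdp_states M \<Longrightarrow> mdp_label M s = mdp_label N s"
proof -
  obtain n m k where Mc: "mdp_states M = {..<n}" "mdp_actions M = {..<m}" "mdp_AP M = {..<k}"
    using M by (auto simp: input_mdp_def)
  obtain n' m' k' where Nc: "mdp_states N = {..<n'}" "mdp_actions N = {..<m'}" "mdp_AP N = {..<k'}"
    using N by (auto simp: input_mdp_def)
  have n: "n' = n" "m' = m" "k' = k" and init: "mdp_init M = mdp_init N"
    using eq by (auto simp: encode_mdp_def Mc Nc list_encode_eq int_encode_eq simp del: list_encode.simps)
  show "mdp_states M = mdp_states N" "mdp_actions M = mdp_actions N" "mdp_init M = mdp_init N"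
    "mdp_AP M = mdp_AP N"
    using n init Mc Nc by auto
  have tr: "encode_rational (pmf (mdp_trans M s a) t) = encode_rational (pmf (mdp_trans N s a) t)"
    if "s < n" "a < m" "t < n" for s a t
    using eq that by (auto simp: encode_mdp_def Mc Nc n list_encode_eq int_encode_eq simp del: list_encode.simps)
  have lab: "set_encode (mdp_label M s) = set_encode (mdp_label N s)" if "s < n" for s
    using eq that by (auto simp: encode_mdp_def Mc Nc n list_encode_eq int_encode_eq simp del: list_encode.simps)
  show "mdp_trans M s a = mdp_trans N s a" if "s \<in> mdp_states M" "a \<in> mdp_actions M" for s a
  proof (rule pmf_eqI)
    fix t
    have sub: "set_pmf (mdp_trans M s a) \<subseteq> {..<n}" "set_pmf (mdp_trans N s a) \<subseteq> {..<n}"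
      and rat: "pmf (mdp_trans M s a) t \<in> \<rat>" "pmf (mdp_trans N s a) t \<in> \<rat>"
      using M N that Mc Nc n by (auto simp: input_mdp_def is_mdp_def)
    show "pmf (mdp_trans M s a) t = pmf (mdp_trans N s a) t"
    proof (cases "t < n")
      case True
      then show ?thesis using tr that Mc rat encode_rational_inj by auto
    next
      case False
      then have "t \<notin> set_pmf (mdp_trans M s a)" "t \<notin> set_pmf (mdp_trans N s a)" using sub by auto
      then show ?thesis by (simp add: set_pmf_iff)
    qed
  qed
  show "mdp_label M s = mdp_label N s" if s: "s \<in> mdp_states M" for s
  proof -
    have "mdp_label M s \<subseteq> {..<k}" "mdp_label N s \<subseteq> {..<k}"
      using M N s Mc Nc n by (auto simp: input_mdp_def is_mdp_def)
    then have "finite (mdp_label M s)" "finite (mdp_label N s)"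
      using finite_subset by auto
    then show ?thesis using lab[of s] s Mc by (simp add: set_encode_eq)
  qed
qed

definition flat_global_window_synthesis :: "nat set" where
  "flat_global_window_synthesis =
     {encode_instance M \<Phi> | M \<Phi>.
        input_mdp M \<and> wf_sform (mdp_AP M) \<Phi> \<and> window \<Phi> \<and> flat \<Phi> \<and>
        (\<exists>\<sigma>. is_strategy M \<sigma> \<and> mc_sat_AG (induced_mc M \<sigma>) \<Phi>)}"

section \<open>Recursive functions\<close>

datatype recf =
    Zero
  | Succ
  | Proj nat
  | Comp recf "recf list"
  | PrimRec recf recf
  | Mu recf

text \<open>\<open>rec_eval r xs y\<close>: the partial recursive function given by \<open>r\<close> is defined on the arguments
  \<open>xs\<close> and has value \<open>y\<close>.\<close>

inductive rec_eval :: "recf \<Rightarrow> nat list \<Rightarrow> nat \<Rightarrow> bool" where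
  zero: "rec_eval Zero xs 0"
| succ: "rec_eval Succ [x] (Suc x)"
| proj: "i < length xs \<Longrightarrow> rec_eval (Proj i) xs (xs ! i)"
| comp: "list_all2 (\<lambda>h y. rec_eval h xs y) hs ys \<Longrightarrow> rec_eval g ys z \<Longrightarrow> rec_eval (Comp g hs) xs z"
| primrec_0: "rec_eval g xs z \<Longrightarrow> rec_eval (PrimRec g h) (0 # xs) z"
| primrec_Suc: "rec_eval (PrimRec g h) (n # xs) y \<Longrightarrow> rec_eval h (n # y # xs) z \<Longrightarrow>
    rec_eval (PrimRec g h) (Suc n # xs) z"
| mu: "rec_eval f (n # xs) 0 \<Longrightarrow> (\<And>m. m < n \<Longrightarrow> \<exists>y. rec_eval f (m # xs) (Suc y)) \<Longrightarrow>
    rec_eval (Mu f) xs n"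

inductive_cases rec_evalE:
  "rec_eval Zero xs z"
  "rec_eval Succ xs z"
  "rec_eval (Proj i) xs z"
  "rec_eval (Comp g hs) xs z"
  "rec_eval (PrimRec g h) (0 # xs) z"
  "rec_eval (PrimRec g h) (Suc n # xs) z"
  "rec_eval (Mu f) xs z"

lemma rec_eval_deterministic: "rec_eval r xs y \<Longrightarrow> rec_eval r xs z \<Longrightarrow> y = z"
proof (induction arbitrary: z rule: rec_eval.induct)
  case (zero xs)
  then show ?case by (rule rec_evalE(1)) simp
next
  case (succ x)
  then show ?case by (rule rec_evalE(2)) simp
next
  case (proj i xs)
  from proj.prems show ?case by (rule rec_evalE(3)) simp
next
  case (comp xs hs ys g w)
  from comp.prems obtain ys' where ys': "list_all2 (\<lambda>h y. rec_eval h xs y) hs ys'" "rec_eval g ys' z"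
    by (rule rec_evalE(4))
  have "ys = ys'"
    using comp.IH(1) ys'(1) by (simp add: list_all2_conv_all_nth nth_equalityI)
  with ys'(2) comp.IH(2) show ?case by simp
next
  case (primrec_0 g xs w h)
  from primrec_0.prems have "rec_eval g xs z" by (rule rec_evalE(5))
  then show ?case by (rule primrec_0.IH)
next
  case (primrec_Suc g h n xs y w)
  from primrec_Suc.prems obtain y' where "rec_eval (PrimRec g h) (n # xs) y'" "rec_eval h (n # y' # xs) z"
    by (rule rec_evalE(6))
  with primrec_Suc.IH show ?case by simp
next
  case (mu f n xs)
  have z: "rec_eval f (z # xs) 0"
    using mu.prems by (rule rec_evalE(7))
  have less: "\<exists>y. rec_eval f (m # xs) (Suc y)" if "m < z" for m
    using mu.prems by (rule rec_evalE(7)) (use that in simp)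
  show ?case
  proof (cases n z rule: linorder_cases)
    case less
    with \<open>\<And>m. m < z \<Longrightarrow> \<exists>y. rec_eval f (m # xs) (Suc y)\<close> obtain y where "rec_eval f (n # xs) (Suc y)"
      by blast
    then show ?thesis using mu.IH(1) by blast
  next
    case greater
    then show ?thesis using z mu.IH(2) by blast
  qed
qed

definition total_recursive :: "(nat \<Rightarrow> nat) \<Rightarrow> bool" where
  "total_recursive f \<longleftrightarrow> (\<exists>r. \<forall>x. rec_eval r [x] (f x))"

definition many_one_reducible :: "nat set \<Rightarrow> nat set \<Rightarrow> bool" where
  "many_one_reducible A B \<longleftrightarrow> (\<exists>f. total_recursive f \<and> (\<forall>x. x \<in> A \<longleftrightarrow> f x \<in> B))"

section \<open>The class of Sigma-1-1 sets\<close>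

datatype aterm = AVar nat | AZero | ASuc aterm | AAdd aterm aterm | AMul aterm aterm

text \<open>Arithmetical formulas of second-order arithmetic: number quantifiers only, and free set
  variables.  Number and set variables are indexed by natural numbers.\<close>

datatype aform =
    AEq aterm aterm
  | AMem aterm nat
  | ANot aform
  | AAnd aform aform
  | AEx nat aform

primrec aterm_val :: "(nat \<Rightarrow> nat) \<Rightarrow> aterm \<Rightarrow> nat" where
  "aterm_val e (AVar i) = e i"
| "aterm_val e AZero = 0"
| "aterm_val e (ASuc t) = Suc (aterm_val e t)"
| "aterm_val e (AAdd t u) = aterm_val e t + aterm_val e u"
| "aterm_val e (AMul t u) = aterm_val e t * aterm_val e u"

primrec aform_holds :: "(nat \<Rightarrow> nat set) \<Rightarrow> (nat \<Rightarrow> nat) \<Rightarrow> aform \<Rightarrow> bool" where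
  "aform_holds X e (AEq t u) \<longleftrightarrow> aterm_val e t = aterm_val e u"
| "aform_holds X e (AMem t j) \<longleftrightarrow> aterm_val e t \<in> X j"
| "aform_holds X e (ANot \<phi>) \<longleftrightarrow> \<not> aform_holds X e \<phi>"
| "aform_holds X e (AAnd \<phi> \<psi>) \<longleftrightarrow> aform_holds X e \<phi> \<and> aform_holds X e \<psi>"
| "aform_holds X e (AEx i \<phi>) \<longleftrightarrow> (\<exists>n. aform_holds X (e(i := n)) \<phi>)"

text \<open>\<open>A\<close> is defined by a formula consisting of a block of existential set quantifiers followed by
  an arithmetical formula.  Only finitely many set variables occur in \<open>\<phi>\<close>, so quantifying over the
  whole assignment \<open>X\<close> amounts to a finite block.  The free number variable is \<open>AVar 0\<close>; any other
  free one stands for \<open>0\<close>.\<close>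

definition sigma11 :: "nat set \<Rightarrow> bool" where
  "sigma11 A \<longleftrightarrow> (\<exists>\<phi>. \<forall>x. x \<in> A \<longleftrightarrow> (\<exists>X. aform_holds X ((\<lambda>_. 0)(0 := x)) \<phi>))"

definition sigma11_hard :: "nat set \<Rightarrow> bool" where
  "sigma11_hard B \<longleftrightarrow> (\<forall>A. sigma11 A \<longrightarrow> many_one_reducible A B)"

end

theory Submission
  imports Defs
begin

text \<open>
  A strategy can store a vector of reals in \<open>[0,1]\<close> at a node of the induced Markov chain: the
  entries are the probabilities of an action in display states visited next.  A linear constraint
  on probabilities two and three steps ahead relates the vector of a node to those of its children,
  so solving an instance means labelling an infinite tree subject to local linear constraints.

  Such trees evaluate arithmetical formulas with set parameters.  With a unit \<open>\<epsilon> > 0\<close>, a number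
  \<open>n\<close> is stored as \<open>n \<epsilon>\<close> and a set as \<open>r \<epsilon>\<close>, where the base-3 digits of \<open>r\<close> are its
  characteristic function.  All constraints are homogeneous, so a whole vector may be halved to make
  room for an increment.  A universal quantifier is a branch counting upwards forever which evaluates
  the body at every stage.  An existential one counts upwards until the strategy decides to stop; it
  cannot go on forever, because a guessed \<open>p > 0\<close> doubles in every round.  Multiplication and
  membership are checked by counting downwards, which ends because probabilities are nonnegative.
  Existential set quantifiers are guesses of reals at the root, and the input \<open>x\<close> is a coefficient.
\<close>

section \<open>Marginals of the path measure\<close>

primrec kstep :: "('s \<Rightarrow> 's pmf) \<Rightarrow> nat \<Rightarrow> 's \<Rightarrow> 's pmf" where
  "kstep K 0 s = return_pmf s"
| "kstep K (Suc n) s = bind_pmf (kstep K n s) K"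

text \<open>\<open>kstep\<close> appends steps at the end, as the Ionescu-Tulcea construction does;
  evaluating formulas unfolds the chain from its first step instead.\<close>

lemma kstep_Suc_left: "kstep K (Suc n) s = bind_pmf (K s) (kstep K n)"
proof (induction n)
  case (Suc n)
  have "kstep K (Suc (Suc n)) s = bind_pmf (bind_pmf (K s) (kstep K n)) K"
    using Suc by simp
  then show ?case by (simp add: bind_assoc_pmf)
qed (simp add: bind_return_pmf bind_return_pmf')

text \<open>The kernel that draws coordinate \<open>n\<close> looks only at coordinate
  \<open>n - 1\<close>. Integrating out the last coordinate thus leaves a function of the previous
  one, and the induction applies because \<open>f\<close> is arbitrary. Coordinate 0 is
  \<open>s\<close> itself, so \<open>Suc n\<close> coordinates make \<open>n\<close> steps.\<close>

lemma nn_integral_step_C: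
  fixes K :: "'s \<Rightarrow> 's pmf" and f :: "'s \<Rightarrow> ennreal"
  shows "(\<integral>\<^sup>+\<omega>. f (\<omega> n)
      \<partial>Ionescu_Tulcea.C (step_kernel K s) (\<lambda>_. count_space UNIV) 0 (Suc n) (\<lambda>_. undefined)) =
    (\<integral>\<^sup>+y. f y \<partial>measure_pmf (kstep K n s))"
proof -
  interpret Ionescu_Tulcea "step_kernel K s" "\<lambda>_. count_space UNIV"
    by (rule Ionescu_Tulcea_step_kernel)
  let ?u = "\<lambda>_::nat. undefined :: 's"
  have last: "(\<integral>\<^sup>+\<omega>. f (\<omega> n) \<partial>C 0 (Suc n) ?u) =
      (\<integral>\<^sup>+\<omega>. (\<integral>\<^sup>+y. f y \<partial>step_kernel K s n \<omega>) \<partial>C 0 n ?u)" for f :: "'s \<Rightarrow> ennreal" and n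
  proof -
    have f: "(\<lambda>\<omega>. f (\<omega> n)) \<in> borel_measurable (PiM {0..<Suc n} (\<lambda>_. count_space UNIV))"
      by (rule measurable_compose[OF measurable_component_singleton]) auto
    have "(\<integral>\<^sup>+\<omega>. f (\<omega> n) \<partial>C 0 (Suc n) ?u) = (\<integral>\<^sup>+\<omega>. (\<integral>\<^sup>+\<omega>'. f (\<omega>' n) \<partial>eP n \<omega>) \<partial>C 0 n ?u)"
      by (simp, subst nn_integral_bind[where B="PiM {0..<Suc n} (\<lambda>_. count_space UNIV)"])
         (auto simp: space_C extensional_def measurable_cong_sets[OF sets_C] f intro!: measurable_eP)
    also have "\<dots> = (\<integral>\<^sup>+\<omega>. (\<integral>\<^sup>+y. f y \<partial>step_kernel K s n \<omega>) \<partial>C 0 n ?u)"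
    proof (rule nn_integral_cong)
      fix \<omega> assume "\<omega> \<in> space (C 0 n ?u)"
      then have w: "\<omega> \<in> extensional {0..<n}"
        using space_C[of ?u 0 n] by (auto simp: extensional_def space_PiM PiE_def)
      show "(\<integral>\<^sup>+\<omega>'. f (\<omega>' n) \<partial>eP n \<omega>) = (\<integral>\<^sup>+y. f y \<partial>step_kernel K s n \<omega>)"
        using w f by (subst nn_integral_eP) (auto simp: space_PiM PiE_def)
    qed
    finally show ?thesis .
  qed
  show ?thesis
  proof (induction n arbitrary: f)
    case 0
    show ?case
      by (subst last) (simp add: step_kernel_def nn_integral_return)
  next
    case (Suc n)
    show ?case
      by (subst last) (simp add: step_kernel_def Suc.IH[of "\<lambda>y. \<integral>\<^sup>+z. f z \<partial>measure_pmf (K y)"] del: C.simps)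
  qed
qed

text \<open>The event is a cylinder over the first \<open>Suc n\<close> coordinates, where the
  projective limit agrees with the finite-dimensional measure.\<close>

lemma measure_path_measure_at:
  fixes K :: "'s \<Rightarrow> 's pmf"
  shows "measure (path_measure K s) {\<omega>. \<omega> n \<in> T} = measure_pmf.prob (kstep K n s) T"
proof -
  interpret Ionescu_Tulcea "step_kernel K s" "\<lambda>_. count_space UNIV"
    by (rule Ionescu_Tulcea_step_kernel)
  let ?J = "{0..<Suc n}" and ?u = "\<lambda>_::nat. undefined :: 's"
  let ?A = "{\<omega> \<in> space (PiM ?J (\<lambda>_. count_space (UNIV :: 's set))). \<omega> n \<in> T}"
  have "(\<lambda>\<omega>. \<omega> n) -` T \<inter> space (PiM ?J (\<lambda>_. count_space (UNIV :: 's set)))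
      \<in> sets (PiM ?J (\<lambda>_. count_space UNIV))"
    by (rule measurable_sets[OF measurable_component_singleton]) auto
  then have A: "?A \<in> sets (PiM ?J (\<lambda>_. count_space UNIV))"
    by (simp add: vimage_def Int_def conj_commute)
  have cyl: "{\<omega>. \<omega> n \<in> T} = PF.emb UNIV ?J ?A"
    by (auto simp: prod_emb_def space_PiM PiE_def)
  have "emeasure (path_measure K s) {\<omega>. \<omega> n \<in> T} = emeasure (CI ?J) ?A"
    unfolding path_measure_def cyl by (rule lim) (use A in auto)
  also have "\<dots> = emeasure (C 0 (Suc n) ?u) ?A"
  proof -
    have "prod_emb ?J (\<lambda>_. count_space UNIV) ?J ?A = ?A"
      using sets.sets_into_space[OF A] by (intro prod_emb_id) (simp add: space_PiM)
    then show ?thesis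
      using A by (subst emeasure_CI[where n="Suc n"]) (auto simp del: C.simps)
  qed
  also have "\<dots> = (\<integral>\<^sup>+\<omega>. indicator ?A \<omega> \<partial>C 0 (Suc n) ?u)"
  proof -
    have "sets (C 0 (Suc n) ?u) = sets (PiM ?J (\<lambda>_. count_space UNIV))"
      using sets_C[of ?u 0 "Suc n"] by (simp add: extensional_def space_PiM PiE_def del: C.simps)
    then show ?thesis using A by (simp del: C.simps)
  qed
  also have "\<dots> = (\<integral>\<^sup>+\<omega>. indicator T (\<omega> n) \<partial>C 0 (Suc n) ?u)"
  proof (rule nn_integral_cong)
    fix \<omega> assume "\<omega> \<in> space (C 0 (Suc n) ?u)"
    then have "\<omega> \<in> space (PiM ?J (\<lambda>_. count_space UNIV))"
      using space_C[of ?u 0 "Suc n"] by (simp add: extensional_def space_PiM PiE_def del: C.simps)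
    then show "indicator ?A \<omega> = (indicator T (\<omega> n) :: ennreal)" by (auto split: split_indicator)
  qed
  also have "\<dots> = emeasure (measure_pmf (kstep K n s)) T"
    by (subst nn_integral_step_C) simp
  finally show ?thesis by (simp add: measure_def)
qed

section \<open>Trees with local linear constraints\<close>

lemma measure_bind_pmf:
  "measure_pmf.prob (bind_pmf p f) T = (\<integral>x. measure_pmf.prob (f x) T \<partial>measure_pmf p)"
  unfolding measure_pmf_bind
  by (rule measure_pmf.measure_bind[where N="count_space UNIV"]) (auto simp: measure_subprob)

section \<open>Linear constraints on labelled trees\<close>

text \<open>\<open>Cur i\<close> is entry \<open>i\<close> of a node's own vector,
  \<open>Chd q i\<close> entry \<open>i\<close> of its child of type \<open>q\<close>.\<close>

datatype lvar = Cur nat | Chd nat nat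

text \<open>Linear combinations are compared with 0 only, so a common positive factor in the
  probabilities that represent the entries is harmless.\<close>

datatype lform = Lin "(int \<times> lvar) list" comparison | LAnd lform lform | LOr lform lform

primrec lvar_val :: "(nat \<Rightarrow> real) \<Rightarrow> (nat \<Rightarrow> nat \<Rightarrow> real) \<Rightarrow> lvar \<Rightarrow> real" where
  "lvar_val v u (Cur i) = v i"
| "lvar_val v u (Chd q i) = u q i"

primrec lform_holds :: "(nat \<Rightarrow> real) \<Rightarrow> (nat \<Rightarrow> nat \<Rightarrow> real) \<Rightarrow> lform \<Rightarrow> bool" where
  "lform_holds v u (Lin ts cmp) \<longleftrightarrow>
     cmp_holds cmp (\<Sum>(c, x)\<leftarrow>ts. real_of_int c * lvar_val v u x) 0"
| "lform_holds v u (LAnd f g) \<longleftrightarrow> lform_holds v u f \<and> lform_holds v u g"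
| "lform_holds v u (LOr f g) \<longleftrightarrow> lform_holds v u f \<or> lform_holds v u g"

primrec lvar_ok :: "nat \<Rightarrow> nat \<Rightarrow> lvar \<Rightarrow> bool" where
  "lvar_ok Q k (Cur i) \<longleftrightarrow> i < k"
| "lvar_ok Q k (Chd q i) \<longleftrightarrow> q < Q \<and> i < k"

primrec lform_ok :: "nat \<Rightarrow> nat \<Rightarrow> lform \<Rightarrow> bool" where
  "lform_ok Q k (Lin ts cmp) \<longleftrightarrow> ts \<noteq> [] \<and> (\<forall>(c, x)\<in>set ts. lvar_ok Q k x)"
| "lform_ok Q k (LAnd f g) \<longleftrightarrow> lform_ok Q k f \<and> lform_ok Q k g"
| "lform_ok Q k (LOr f g) \<longleftrightarrow> lform_ok Q k f \<and> lform_ok Q k g"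

lemma lform_holds_cong:
  assumes "lform_ok Q k f" "\<And>i. i < k \<Longrightarrow> v i = v' i" "\<And>q i. q < Q \<Longrightarrow> i < k \<Longrightarrow> u q i = u' q i"
  shows "lform_holds v u f \<longleftrightarrow> lform_holds v' u' f"
  using assms(1)
proof (induction f)
  case (Lin ts cmp)
  have "lvar_val v u x = lvar_val v' u' x" if "(c, x) \<in> set ts" for c x
    using that Lin assms(2,3) by (cases x) auto
  then have "(\<Sum>(c, x)\<leftarrow>ts. real_of_int c * lvar_val v u x) =
      (\<Sum>(c, x)\<leftarrow>ts. real_of_int c * lvar_val v' u' x)"
    by (intro arg_cong[where f=sum_list] map_cong) auto
  then show ?case by simp
qed auto

text \<open>A coinductive form of the existence of an infinite tree: each pair of a type and a
  vector in \<open>W\<close> can be given one child of every type within \<open>W\<close>. The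
  choice may depend on the pair alone, so positions in the tree need not be recorded.\<close>

definition consistent :: "nat \<Rightarrow> nat \<Rightarrow> (nat \<Rightarrow> lform) \<Rightarrow> (nat \<times> (nat \<Rightarrow> real)) set \<Rightarrow> bool" where
  "consistent Q k R W \<longleftrightarrow> (\<forall>(q, v)\<in>W. q < Q \<and> (\<forall>i<k. 0 \<le> v i \<and> v i \<le> 1) \<and>
     (\<exists>u. (\<forall>q'<Q. (q', u q') \<in> W) \<and> lform_holds v u (R q)))"

section \<open>The MDP whose strategies label a tree\<close>

text \<open>\<open>Ctl q\<close> is a tree node of type \<open>q\<close>, and \<open>Dsp q i\<close>
  displays entry \<open>i\<close> of its vector as the probability of moving on to
  \<open>Yes q i\<close>. Displays carry the type so that entries of different children can be told
  apart.\<close>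

datatype gst = Ctl nat | Dsp nat nat | Yes nat nat | Snk | Bad

instance gst :: countable
  by countable_datatype

abbreviation cd :: "gst \<Rightarrow> nat" where
  "cd \<equiv> to_nat"

definition gstates :: "nat \<Rightarrow> nat \<Rightarrow> gst set" where
  "gstates Q k = {Snk, Bad} \<union> Ctl ` {..<Q} \<union> (\<lambda>(q, i). Dsp q i) ` ({..<Q} \<times> {..<k}) \<union>
     (\<lambda>(q, i). Yes q i) ` ({..<Q} \<times> {..<k})"

lemma finite_gstates [simp]: "finite (gstates Q k)"
  by (simp add: gstates_def)

lemma gstates_simps [simp]:
  "Snk \<in> gstates Q k" "Bad \<in> gstates Q k" "Ctl q \<in> gstates Q k \<longleftrightarrow> q < Q"
  "Dsp q i \<in> gstates Q k \<longleftrightarrow> q < Q \<and> i < k" "Yes q i \<in> gstates Q k \<longleftrightarrow> q < Q \<and> i < k"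
  by (auto simp: gstates_def)

definition gsize :: "nat \<Rightarrow> nat \<Rightarrow> nat" where
  "gsize Q k = Suc (Max (cd ` gstates Q k))"

lemma cd_less_gsize: "s \<in> gstates Q k \<Longrightarrow> cd s < gsize Q k"
  by (simp add: gsize_def less_Suc_eq_le)

definition gsucc :: "nat \<Rightarrow> nat \<Rightarrow> nat \<Rightarrow> nat set" where
  "gsucc Q k q = cd ` (Ctl ` {..<Q} \<union> Dsp q ` {..<k})"

lemma finite_gsucc [simp]: "finite (gsucc Q k q)"
  by (simp add: gsucc_def)

lemma card_gsucc [simp]: "card (gsucc Q k q) = Q + k"
proof -
  have "card (gsucc Q k q) = card (Ctl ` {..<Q} \<union> Dsp q ` {..<k})"
    unfolding gsucc_def by (rule card_image) (auto intro: inj_onI)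
  also have "\<dots> = card (Ctl ` {..<Q}) + card (Dsp q ` {..<k})"
    by (rule card_Un_disjoint) auto
  also have "\<dots> = Q + k"
    by (simp add: card_image inj_on_def)
  finally show ?thesis .
qed

lemma cd_in_gsucc [simp]:
  "cd s \<in> gsucc Q k q \<longleftrightarrow> (\<exists>q'<Q. s = Ctl q') \<or> (\<exists>i<k. s = Dsp q i)"
  by (auto simp: gsucc_def)

lemma gsuccE:
  assumes "t \<in> gsucc Q k q"
  obtains q' where "q' < Q" "t = cd (Ctl q')" | i where "i < k" "t = cd (Dsp q i)"
  using assms by (auto simp: gsucc_def)

text \<open>Excluding \<open>Bad\<close> forces action 0 in control states.  A strategy that randomised there would give
  a child several copies, and the constraints would only see the average of their vectors.\<close>

fun gtrans :: "nat \<Rightarrow> nat \<Rightarrow> gst \<Rightarrow> nat \<Rightarrow> nat pmf" where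
  "gtrans Q k (Ctl q) a = (if a = 0 then pmf_of_set (gsucc Q k q) else return_pmf (cd Bad))"
| "gtrans Q k (Dsp q i) a = return_pmf (cd (if a = 0 then Snk else Yes q i))"
| "gtrans Q k s a = return_pmf (cd Snk)"

lemma set_pmf_gtrans_Ctl:
  "q < Q \<Longrightarrow> set_pmf (gtrans Q k (Ctl q) a) = (if a = 0 then gsucc Q k q else {cd Bad})"
  by (metis card_gsucc card.empty add_eq_0_iff_both_eq_0 finite_gsucc gtrans.simps(1) not_less_zero
      set_pmf_of_set set_return_pmf)

lemma set_pmf_gtrans:
  assumes "s \<in> gstates Q k"
  shows "set_pmf (gtrans Q k s a) \<subseteq> cd ` gstates Q k"
proof (cases s)
  case (Ctl q)
  then show ?thesis
    using assms set_pmf_gtrans_Ctl[of q Q k a] by (auto simp: gsucc_def)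
qed (use assms in auto)

text \<open>An input MDP has an initial segment as its state set, whereas the codes of
  \<open>gstates\<close> may leave gaps. Numbers in the gaps move to \<open>Snk\<close>, and
  \<open>gtrans\<close> never enters them.\<close>

definition gmdp :: "nat \<Rightarrow> nat \<Rightarrow> nat \<Rightarrow> (nat, nat, nat) mdp" where
  "gmdp Q k q0 = \<lparr> mdp_states = {..<gsize Q k}, mdp_actions = {..<2}, mdp_init = cd (Ctl q0),
     mdp_trans = (\<lambda>s. if s \<in> cd ` gstates Q k then gtrans Q k (from_nat s) else (\<lambda>_. return_pmf (cd Snk))),
     mdp_AP = {..<gsize Q k}, mdp_label = (\<lambda>s. {s}) \<rparr>"

lemma pmf_gtrans_Rats: "s \<in> gstates Q k \<Longrightarrow> pmf (gtrans Q k s a) t \<in> \<rat>"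
proof (cases s)
  case (Ctl q)
  moreover assume "s \<in> gstates Q k"
  ultimately have "gsucc Q k q \<noteq> {}"
    by (metis gstates_simps(3) cd_in_gsucc empty_iff)
  then show ?thesis using Ctl
    by (simp add: pmf_of_set indicator_def pmf_return)
qed (auto simp: indicator_def pmf_return)

lemma input_mdp_gmdp:
  assumes "q0 < Q"
  shows "input_mdp (gmdp Q k q0)"
proof -
  have sub: "cd ` gstates Q k \<subseteq> {..<gsize Q k}"
    using cd_less_gsize by auto
  have "set_pmf (gtrans Q k s a) \<subseteq> {..<gsize Q k}" if "s \<in> gstates Q k" for s a
    using set_pmf_gtrans[OF that] sub by blast
  moreover have "cd Snk < gsize Q k" "cd (Ctl q0) < gsize Q k" "gsize Q k \<noteq> 0"
    using assms by (auto intro!: cd_less_gsize) (simp add: gsize_def)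
  ultimately show ?thesis
    unfolding input_mdp_def is_mdp_def gmdp_def
    by (auto simp: pmf_gtrans_Rats indicator_def pmf_return split: if_splits) blast
qed

section \<open>Translation of the constraints into flat window formulas\<close>

text \<open>A node's own displays answer after two steps, those of its children after three. Each
  step out of a control state costs a factor \<open>1 / (Q + k)\<close>; scaling the coefficients of
  children by \<open>Q + k\<close> gives all terms the same factor.\<close>

primrec lform_sform :: "nat \<Rightarrow> nat \<Rightarrow> nat \<Rightarrow> lform \<Rightarrow> nat sform" where
  "lform_sform Q k q (Lin ts cmp) = PSum (map (\<lambda>(c, x). case x of
       Cur i \<Rightarrow> (c, Next 2 (Atom (cd (Yes q i))))
     | Chd q' i \<Rightarrow> (c * int (Q + k), Next 3 (Atom (cd (Yes q' i))))) ts) cmp 0"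
| "lform_sform Q k q (LAnd f g) = Conj (lform_sform Q k q f) (lform_sform Q k q g)"
| "lform_sform Q k q (LOr f g) = Disj (lform_sform Q k q f) (lform_sform Q k q g)"

text \<open>The formula is evaluated at all reachable states, displays included, so each rule is
  guarded by the atom of its control state.\<close>

definition gform :: "nat \<Rightarrow> nat \<Rightarrow> (nat \<Rightarrow> lform) \<Rightarrow> nat sform" where
  "gform Q k R = foldr Conj (map (\<lambda>q. Disj (NegAtom (cd (Ctl q))) (lform_sform Q k q (R q))) [0..<Q])
     (NegAtom (cd Bad))"

lemma lform_sform_wf:
  assumes "q < Q" "lform_ok Q k f"
  shows "wf_sform {..<gsize Q k} (lform_sform Q k q f)" "window (lform_sform Q k q f)"
    "flat (lform_sform Q k q f)"
  using assms(2)
  by (induction f) (auto split: lvar.splits intro!: cd_less_gsize simp: assms(1) dest!: bspec)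

lemma gform_wf:
  assumes "\<And>q. q < Q \<Longrightarrow> lform_ok Q k (R q)"
  shows "wf_sform {..<gsize Q k} (gform Q k R)" "window (gform Q k R)" "flat (gform Q k R)"
proof -
  have fold: "P (foldr Conj xs b) \<longleftrightarrow> (\<forall>x\<in>set xs. P x) \<and> P b"
    if "\<And>f g. P (Conj f g) \<longleftrightarrow> P f \<and> P g" for P and xs :: "nat sform list" and b
    by (induction xs) (auto simp: that)
  show "wf_sform {..<gsize Q k} (gform Q k R)"
    unfolding gform_def using assms
    by (subst fold) (auto intro!: cd_less_gsize lform_sform_wf)
  show "window (gform Q k R)"
    unfolding gform_def using assms by (subst fold) (auto intro!: lform_sform_wf)
  show "flat (gform Q k R)"
    unfolding gform_def using assms by (subst fold) (auto intro!: lform_sform_wf)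
qed

lemma sat_foldr_Conj:
  "sat C s (foldr Conj xs b) \<longleftrightarrow> (\<forall>x\<in>set xs. sat C s x) \<and> sat C s b"
  by (induction xs) auto

text \<open>Only the values on codes of states matter: an MDP is determined by its code merely up to its
  behaviour outside the state and action sets.\<close>

locale gadget =
  fixes Q k q0 :: nat and M :: "(nat, nat, nat) mdp" and \<sigma> :: "(nat, nat) fpath \<Rightarrow> nat pmf"
  assumes q0: "q0 < Q"
    and states: "mdp_states M = {..<gsize Q k}" and actions: "mdp_actions M = {..<2}"
    and init: "mdp_init M = cd (Ctl q0)"
    and trans: "s \<in> gstates Q k \<Longrightarrow> a < 2 \<Longrightarrow> mdp_trans M (cd s) a = gtrans Q k s a"
    and label: "s \<in> gstates Q k \<Longrightarrow> mdp_label M (cd s) = {cd s}"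
    and strategy: "is_strategy M \<sigma>"
begin

abbreviation "C \<equiv> induced_mc M \<sigma>"
abbreviation "K \<equiv> mc_trans C"

definition node :: "gst \<Rightarrow> (nat, nat) fpath \<Rightarrow> bool" where
  "node s \<rho> \<longleftrightarrow> is_fpath M \<rho> \<and> last_state \<rho> = cd s \<and> s \<in> gstates Q k"

lemma actions_less: "node s \<rho> \<Longrightarrow> a \<in> set_pmf (\<sigma> \<rho>) \<Longrightarrow> a < 2"
  using strategy by (auto simp: node_def is_strategy_def actions)

lemma K_node: "node s \<rho> \<Longrightarrow> K \<rho> = bind_pmf (\<sigma> \<rho>) (\<lambda>a. map_pmf (Step \<rho> a) (gtrans Q k s a))"
  unfolding induced_mc_def using actions_less[of s \<rho>]
  by (auto simp: node_def trans intro!: bind_pmf_cong)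

lemma node_Step:
  "node s \<rho> \<Longrightarrow> a < 2 \<Longrightarrow> cd t \<in> set_pmf (gtrans Q k s a) \<Longrightarrow> node t (Step \<rho> a (cd t))"
  using set_pmf_gtrans[of s Q k a]
  by (auto simp: node_def actions states trans cd_less_gsize pmf_positive_iff)

lemma set_pmf_K:
  assumes "node s \<rho>" "\<rho>' \<in> set_pmf (K \<rho>)"
  obtains a t where "\<rho>' = Step \<rho> a (cd t)" "a \<in> set_pmf (\<sigma> \<rho>)" "a < 2"
    "cd t \<in> set_pmf (gtrans Q k s a)" "node t \<rho>'"
proof -
  obtain a y where a: "a \<in> set_pmf (\<sigma> \<rho>)" "y \<in> set_pmf (gtrans Q k s a)" "\<rho>' = Step \<rho> a y"
    using assms by (auto simp: K_node)
  have "s \<in> gstates Q k"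
    using assms(1) by (simp add: node_def)
  then obtain t where t: "y = cd t"
    using a(2) set_pmf_gtrans[of s Q k a] by blast
  have "a < 2"
    using assms(1) a(1) by (rule actions_less)
  moreover from this have "node t \<rho>'"
    using assms(1) a t by (auto intro: node_Step)
  ultimately show ?thesis
    using that a t by blast
qed

section \<open>Vector entries as probabilities in the induced chain\<close>

definition hit :: "nat \<Rightarrow> nat \<Rightarrow> (nat, nat) fpath \<Rightarrow> real" where
  "hit l z \<rho> = measure_pmf.prob (kstep K l \<rho>) {\<rho>'. z \<in> mc_label C \<rho>'}"

lemma measure_Next_Atom:
  "measure (path_measure K \<rho>) {\<omega>. path_sat C \<omega> (Next l (Atom z))} = hit l z \<rho>"
  using measure_path_measure_at[of K \<rho> l "{\<rho>'. z \<in> mc_label C \<rho>'}"] by (simp add: hit_def)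

lemma hit_0: "node s \<rho> \<Longrightarrow> hit 0 (cd t) \<rho> = (if s = t then 1 else 0)"
  by (auto simp: hit_def node_def induced_mc_def label)

lemma hit_Suc: "hit (Suc l) z \<rho> = (\<integral>\<rho>'. hit l z \<rho>' \<partial>measure_pmf (K \<rho>))"
  unfolding hit_def by (simp only: kstep_Suc_left measure_bind_pmf)

lemma hit_Suc_0: "(\<And>\<rho>'. \<rho>' \<in> set_pmf (K \<rho>) \<Longrightarrow> hit l z \<rho>' = 0) \<Longrightarrow> hit (Suc l) z \<rho> = 0"
  unfolding hit_Suc by (intro integral_eq_zero_AE) (simp add: AE_measure_pmf_iff)

text \<open>Action 1 is the only way from \<open>Dsp q i\<close> to \<open>Yes q i\<close>, so the
  probability of that action can be read one step ahead.\<close>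

lemma hit_1_Dsp:
  assumes "node (Dsp q i) \<rho>"
  shows "hit (Suc 0) (cd (Yes q' i')) \<rho> = (if q = q' \<and> i = i' then pmf (\<sigma> \<rho>) 1 else 0)"
proof -
  have K: "K \<rho> = map_pmf (\<lambda>a. Step \<rho> a (cd (if a = 0 then Snk else Yes q i))) (\<sigma> \<rho>)"
    by (simp add: K_node[OF assms] map_pmf_def bind_return_pmf)
  have *: "hit 0 (cd (Yes q' i')) (Step \<rho> a (cd (if a = 0 then Snk else Yes q i))) =
      indicator (if q = q' \<and> i = i' then {1} else {}) a" if "a \<in> set_pmf (\<sigma> \<rho>)" for a
  proof -
    have a: "a < 2" using actions_less[OF assms that] .
    have "node (if a = 0 then Snk else Yes q i) (Step \<rho> a (cd (if a = 0 then Snk else Yes q i)))"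
      by (rule node_Step[OF assms a]) simp
    then show ?thesis
      using a by (subst hit_0) (auto simp: indicator_def less_2_cases_iff)
  qed
  have "hit (Suc 0) (cd (Yes q' i')) \<rho> =
      (\<integral>a. hit 0 (cd (Yes q' i')) (Step \<rho> a (cd (if a = 0 then Snk else Yes q i))) \<partial>measure_pmf (\<sigma> \<rho>))"
    unfolding hit_Suc K by simp
  also have "\<dots> = (\<integral>a. indicator (if q = q' \<and> i = i' then {1} else {}) a \<partial>measure_pmf (\<sigma> \<rho>))"
    by (intro integral_cong_AE) (simp_all add: AE_measure_pmf_iff *)
  also have "\<dots> = (if q = q' \<and> i = i' then pmf (\<sigma> \<rho>) 1 else 0)"
    by (simp add: measure_pmf_single)
  finally show ?thesis .
qed

lemma hit_1_other:
  assumes "node s \<rho>" "s \<noteq> Dsp q i"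
  shows "hit (Suc 0) (cd (Yes q i)) \<rho> = 0"
proof (cases "\<exists>q' i'. s = Dsp q' i'")
  case True
  then show ?thesis using assms by (auto simp: hit_1_Dsp split: if_splits)
next
  case False
  show ?thesis
  proof (rule hit_Suc_0)
    fix \<rho>' assume "\<rho>' \<in> set_pmf (K \<rho>)"
    then obtain a t where t: "cd t \<in> set_pmf (gtrans Q k s a)" "node t \<rho>'"
      by (rule set_pmf_K[OF assms(1)])
    have "s \<in> gstates Q k"
      using assms(1) by (simp add: node_def)
    then have "t \<noteq> Yes q i"
      using t(1) False by (cases s) (auto simp: set_pmf_gtrans_Ctl simp del: gtrans.simps(1) split: if_splits)
    with t(2) show "hit 0 (cd (Yes q i)) \<rho>' = 0"
      by (simp add: hit_0)
  qed
qed

text \<open>A display state is followed by \<open>Snk\<close> or a \<open>Yes\<close> state, and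
  these are followed by \<open>Snk\<close>. Hence the three-step formulas do not see the displays of
  the node itself.\<close>

lemma hit_2_Dsp:
  assumes "node (Dsp q' i') \<rho>"
  shows "hit (Suc (Suc 0)) (cd (Yes q i)) \<rho> = 0"
proof (rule hit_Suc_0)
  fix \<rho>' assume "\<rho>' \<in> set_pmf (K \<rho>)"
  then obtain a t where t: "cd t \<in> set_pmf (gtrans Q k (Dsp q' i') a)" "node t \<rho>'"
    by (rule set_pmf_K[OF assms])
  then show "hit (Suc 0) (cd (Yes q i)) \<rho>' = 0"
    by (intro hit_1_other) (auto split: if_splits)
qed

lemma hit_Suc_Ctl:
  assumes "node (Ctl q) \<rho>" "\<sigma> \<rho> = return_pmf 0"
  shows "hit (Suc l) z \<rho> = (\<Sum>t\<in>gsucc Q k q. hit l z (Step \<rho> 0 t)) / real (Q + k)"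
proof -
  have "q < Q"
    using assms(1) by (simp add: node_def)
  then have ne: "gsucc Q k q \<noteq> {}"
    by (metis cd_in_gsucc empty_iff)
  have "K \<rho> = map_pmf (Step \<rho> 0) (pmf_of_set (gsucc Q k q))"
    by (simp add: K_node[OF assms(1)] assms(2) bind_return_pmf)
  then show ?thesis
    unfolding hit_Suc using ne by (simp add: integral_pmf_of_set)
qed

text \<open>The display state is visited as an extension of the history \<open>\<rho>\<close>, so a
  strategy with memory can choose a new vector at every node.\<close>

definition reg :: "(nat, nat) fpath \<Rightarrow> nat \<Rightarrow> nat \<Rightarrow> real" where
  "reg \<rho> q i = pmf (\<sigma> (Step \<rho> 0 (cd (Dsp q i)))) 1"

lemma node_child:
  assumes "node (Ctl q) \<rho>" "t \<in> gsucc Q k q"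
  obtains q' where "q' < Q" "t = cd (Ctl q')" "node (Ctl q') (Step \<rho> 0 t)"
  | i where "i < k" "t = cd (Dsp q i)" "node (Dsp q i) (Step \<rho> 0 t)"
proof -
  have q: "q < Q"
    using assms(1) by (simp add: node_def)
  have "node s (Step \<rho> 0 (cd s))" if "t = cd s" for s
    using assms that set_pmf_gtrans_Ctl[OF q, of k 0] by (intro node_Step[OF assms(1)]) auto
  then show ?thesis
    using assms(2) that by (elim gsuccE) blast+
qed

text \<open>A path that is in \<open>Yes q' i\<close> after two steps passes through
  \<open>Dsp q' i\<close>, which is a successor of \<open>Ctl q\<close> only if
  \<open>q = q'\<close>.\<close>

lemma hit_2_Ctl:
  assumes "node (Ctl q) \<rho>" "\<sigma> \<rho> = return_pmf 0" "i < k"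
  shows "hit (Suc (Suc 0)) (cd (Yes q' i)) \<rho> = (if q = q' then reg \<rho> q i / real (Q + k) else 0)"
proof -
  have "hit (Suc 0) (cd (Yes q' i)) (Step \<rho> 0 t) =
      (if t = cd (Dsp q i) then if q = q' then reg \<rho> q i else 0 else 0)" if "t \<in> gsucc Q k q" for t
    using assms(1) that by (rule node_child) (auto simp: hit_1_Dsp hit_1_other reg_def)
  then show ?thesis
    using assms(3) by (simp add: hit_Suc_Ctl[OF assms(1,2)])
qed

text \<open>By \<open>hit_2_Dsp\<close> the first step must go to a control state, and by
  \<open>hit_2_Ctl\<close> to the one of type \<open>q'\<close>.\<close>

lemma hit_3_Ctl:
  assumes "node (Ctl q) \<rho>" "\<sigma> \<rho> = return_pmf 0" "i < k" "q' < Q"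
    and "\<And>q'. q' < Q \<Longrightarrow> \<sigma> (Step \<rho> 0 (cd (Ctl q'))) = return_pmf 0"
  shows "hit (Suc (Suc (Suc 0))) (cd (Yes q' i)) \<rho> =
    reg (Step \<rho> 0 (cd (Ctl q'))) q' i / (real (Q + k) * real (Q + k))"
proof -
  have "hit (Suc (Suc 0)) (cd (Yes q' i)) (Step \<rho> 0 t) =
      (if t = cd (Ctl q') then reg (Step \<rho> 0 (cd (Ctl q'))) q' i / real (Q + k) else 0)"
    if "t \<in> gsucc Q k q" for t
    using assms(1) that by (rule node_child) (auto simp: hit_2_Dsp hit_2_Ctl assms(3,5))
  then show ?thesis
    using assms(4) by (simp add: hit_Suc_Ctl[OF assms(1,2)])
qed

lemma sat_lform_sform:
  assumes "node (Ctl q) \<rho>" "\<sigma> \<rho> = return_pmf 0"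
    and "\<And>q'. q' < Q \<Longrightarrow> \<sigma> (Step \<rho> 0 (cd (Ctl q'))) = return_pmf 0"
    and "lform_ok Q k f"
  shows "sat C \<rho> (lform_sform Q k q f) \<longleftrightarrow>
    lform_holds (reg \<rho> q) (\<lambda>q'. reg (Step \<rho> 0 (cd (Ctl q'))) q') f"
  using assms(4)
proof (induction f)
  case (Lin ts cmp)
  let ?N = "real (Q + k)" and ?val = "lvar_val (reg \<rho> q) (\<lambda>q'. reg (Step \<rho> 0 (cd (Ctl q'))) q')"
  have N: "?N > 0"
    using q0 by simp
  have num: "2 = Suc (Suc 0)" "3 = Suc (Suc (Suc 0))"
    by simp_all
  have "(\<Sum>(c, \<phi>)\<leftarrow>map (\<lambda>(c, x). case x of
         Cur i \<Rightarrow> (c, Next 2 (Atom (cd (Yes q i))))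
       | Chd q' i \<Rightarrow> (c * int (Q + k), Next 3 (Atom (cd (Yes q' i))))) ts.
         real_of_int c * measure (path_measure K \<rho>) {\<omega>. path_sat C \<omega> \<phi>}) =
      (\<Sum>(c, x)\<leftarrow>ts. real_of_int c * ?val x / ?N)"
    unfolding map_map comp_def
  proof (intro arg_cong[where f=sum_list] map_cong refl)
    fix cx assume "cx \<in> set ts"
    with Lin obtain c x where cx: "cx = (c, x)" "lvar_ok Q k x" by (cases cx) auto
    show "(case case cx of (c, x) \<Rightarrow> case x of
         Cur i \<Rightarrow> (c, Next 2 (Atom (cd (Yes q i))))
       | Chd q' i \<Rightarrow> (c * int (Q + k), Next 3 (Atom (cd (Yes q' i)))) of
       (c, \<phi>) \<Rightarrow> real_of_int c * measure (path_measure K \<rho>) {\<omega>. path_sat C \<omega> \<phi>}) =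
      (case cx of (c, x) \<Rightarrow> real_of_int c * ?val x / ?N)"
    proof (cases x)
      case (Cur i)
      then show ?thesis
        using cx hit_2_Ctl[OF assms(1,2), of i q]
        by (simp del: path_sat.simps add: measure_Next_Atom num)
    next
      case (Chd q' i)
      then show ?thesis
        using cx hit_3_Ctl[OF assms(1,2) _ _ assms(3), of i q'] N
        by (simp del: path_sat.simps of_nat_add add: measure_Next_Atom num)
    qed
  qed
  also have "\<dots> = (\<Sum>(c, x)\<leftarrow>ts. real_of_int c * ?val x) / ?N"
    by (induction ts) (auto simp: add_divide_distrib)
  finally show ?case
    using N by (cases cmp) (auto simp del: path_sat.simps simp: zero_le_divide_iff zero_less_divide_iff)
qed auto

lemma init_node: "node (Ctl q0) (mc_init C)"
  using q0 by (simp add: node_def induced_mc_def init states cd_less_gsize)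

lemma reachable_induct [consumes 1, case_names init step]:
  assumes "\<rho> \<in> mc_reachable C (mc_init C)"
    and "P (mc_init C)"
    and "\<And>\<rho> \<rho>'. \<rho> \<in> mc_reachable C (mc_init C) \<Longrightarrow> P \<rho> \<Longrightarrow> \<rho>' \<in> set_pmf (K \<rho>) \<Longrightarrow> P \<rho>'"
  shows "P \<rho>"
  using assms(1) unfolding mc_reachable_def mem_Collect_eq
  by (induction rule: rtrancl_induct) (use assms(2,3) in \<open>auto simp: mc_reachable_def\<close>)

lemma reachable_step:
  "\<rho> \<in> mc_reachable C (mc_init C) \<Longrightarrow> \<rho>' \<in> set_pmf (K \<rho>) \<Longrightarrow> \<rho>' \<in> mc_reachable C (mc_init C)"
  unfolding mc_reachable_def by (auto intro: rtrancl_into_rtrancl)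

section \<open>From strategies to consistent sets\<close>

text \<open>\<open>W\<close> collects the vectors displayed at all reachable control nodes. The
  children of a node are its one-step extensions by action 0, which are again reachable.\<close>

lemma consistent_of_sat:
  assumes ok: "\<And>q. q < Q \<Longrightarrow> lform_ok Q k (R q)" and sat: "mc_sat_AG C (gform Q k R)"
  shows "\<exists>W v. consistent Q k R W \<and> (q0, v) \<in> W"
proof (intro exI conjI)
  let ?Re = "mc_reachable C (mc_init C)"
  let ?W = "{(q, reg \<rho> q) | \<rho> q. \<rho> \<in> ?Re \<and> node (Ctl q) \<rho>}"
  have sat': "sat C \<rho> (gform Q k R)" if "\<rho> \<in> ?Re" for \<rho>
    using sat that by (simp add: mc_sat_AG_def sat_AG_def)
  have det: "\<sigma> \<rho> = return_pmf 0" if \<rho>: "\<rho> \<in> ?Re" "node (Ctl q) \<rho>" for \<rho> q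
  proof -
    \<comment> \<open>Any other action would make \<open>Bad\<close> reachable, where the formula
      fails.\<close>
    have "a = 0" if a: "a \<in> set_pmf (\<sigma> \<rho>)" for a
    proof (rule ccontr)
      assume "a \<noteq> 0"
      let ?\<rho> = "Step \<rho> a (cd Bad)"
      have "?\<rho> \<in> set_pmf (K \<rho>)"
        using a \<open>a \<noteq> 0\<close> by (auto simp: K_node[OF \<rho>(2)] intro!: bexI[of _ a])
      then have "?\<rho> \<in> ?Re"
        by (rule reachable_step[OF \<rho>(1)])
      then have "cd Bad \<notin> mc_label C ?\<rho>"
        using sat' by (fastforce simp: gform_def sat_foldr_Conj)
      then show False
        by (simp add: induced_mc_def label)
    qed
    then show ?thesis
      by (auto simp flip: set_pmf_subset_singleton)
  qed
  show "(q0, reg (mc_init C) q0) \<in> ?W"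
    using init_node by (auto simp: mc_reachable_def)
  show "consistent Q k R ?W"
    unfolding consistent_def
  proof (clarify, intro conjI allI impI exI)
    fix q \<rho> assume \<rho>: "\<rho> \<in> ?Re" "node (Ctl q) \<rho>"
    show q: "q < Q"
      using \<rho>(2) by (simp add: node_def)
    show "0 \<le> reg \<rho> q i" "reg \<rho> q i \<le> 1" for i
      by (simp_all add: reg_def pmf_le_1)
    have child: "Step \<rho> 0 (cd (Ctl q')) \<in> ?Re" "node (Ctl q') (Step \<rho> 0 (cd (Ctl q')))"
      if "q' < Q" for q'
    proof -
      have *: "cd (Ctl q') \<in> set_pmf (gtrans Q k (Ctl q) 0)"
        using that q by (simp only: set_pmf_gtrans_Ctl) simp
      then have "Step \<rho> 0 (cd (Ctl q')) \<in> set_pmf (K \<rho>)"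
        by (simp add: K_node[OF \<rho>(2)] det[OF \<rho>] bind_return_pmf del: gtrans.simps)
      then show "Step \<rho> 0 (cd (Ctl q')) \<in> ?Re"
        by (rule reachable_step[OF \<rho>(1)])
      show "node (Ctl q') (Step \<rho> 0 (cd (Ctl q')))"
        using * by (intro node_Step[OF \<rho>(2)]) auto
    qed
    show "(q', reg (Step \<rho> 0 (cd (Ctl q'))) q') \<in> ?W" if "q' < Q" for q'
      using child[OF that] by blast
    have "sat C \<rho> (lform_sform Q k q (R q))"
      using sat'[OF \<rho>(1)] \<rho>(2) q
      by (fastforce simp: gform_def sat_foldr_Conj node_def induced_mc_def label)
    then show "lform_holds (reg \<rho> q) (\<lambda>q'. reg (Step \<rho> 0 (cd (Ctl q'))) q') (R q)"
      using sat_lform_sform[OF \<rho>(2) det[OF \<rho>] _ ok[OF q]] det child by blast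
  qed
qed

end

section \<open>From consistent sets to strategies\<close>

text \<open>The vector remembered along a history. It changes on moves between control states and is
  kept on entering a display state, which has to show the vector of the node just left.\<close>

primrec path_data :: "(nat \<Rightarrow> real) \<Rightarrow> (nat \<Rightarrow> (nat \<Rightarrow> real) \<Rightarrow> nat \<Rightarrow> nat \<Rightarrow> real) \<Rightarrow>
    (nat, nat) fpath \<Rightarrow> nat \<Rightarrow> real" where
  "path_data v U (Start s) = v"
| "path_data v U (Step \<rho> a s) = (case (from_nat (last_state \<rho>), from_nat s) of
     (Ctl q, Ctl q') \<Rightarrow> U q (path_data v U \<rho>) q' | _ \<Rightarrow> path_data v U \<rho>)"

lemma strategy_of_consistent:
  assumes q0: "q0 < Q" and ok: "\<And>q. q < Q \<Longrightarrow> lform_ok Q k (R q)"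
    and W: "consistent Q k R W" "(q0, v) \<in> W"
  shows "\<exists>\<sigma>. is_strategy (gmdp Q k q0) \<sigma> \<and> mc_sat_AG (induced_mc (gmdp Q k q0) \<sigma>) (gform Q k R)"
proof -
  \<comment> \<open>A choice function for the child vectors that depends on type and vector only; it
    lets the strategy compute its memory along the history.\<close>
  obtain U where U: "\<And>q v. (q, v) \<in> W \<Longrightarrow>
      (\<forall>q'<Q. (q', U q v q') \<in> W) \<and> lform_holds v (U q v) (R q)"
  proof -
    have "\<forall>q v. \<exists>u. (q, v) \<in> W \<longrightarrow> (\<forall>q'<Q. (q', u q') \<in> W) \<and> lform_holds v u (R q)"
      using W(1) by (fastforce simp: consistent_def)
    then show ?thesis using that by metis
  qed
  define dat where "dat = path_data v U"
  define \<sigma> :: "(nat, nat) fpath \<Rightarrow> nat pmf" where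
    "\<sigma> = (\<lambda>\<rho>. case from_nat (last_state \<rho>) of
       Dsp q i \<Rightarrow> map_pmf (\<lambda>b. if b then 1 else 0) (bernoulli_pmf (dat \<rho> i)) | _ \<Rightarrow> return_pmf 0)"
  have strat: "is_strategy (gmdp Q k q0) \<sigma>"
    by (auto simp: is_strategy_def gmdp_def \<sigma>_def split: gst.splits)
  interpret gadget Q k q0 "gmdp Q k q0" \<sigma>
    using q0 strat by unfold_locales (auto simp: gmdp_def)
  have inv: "\<exists>s. node s \<rho> \<and> s \<noteq> Bad \<and> (\<forall>q. s = Ctl q \<longrightarrow> (q, dat \<rho>) \<in> W)"
    if "\<rho> \<in> mc_reachable C (mc_init C)" for \<rho>
    using that
  proof (induction rule: reachable_induct)
    case init
    have "dat (mc_init C) = v"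
      by (simp add: induced_mc_def dat_def)
    then show ?case
      using init_node W(2) by auto
  next
    case (step \<rho> \<rho>')
    then obtain s where s: "node s \<rho>" "s \<noteq> Bad" "\<And>q. s = Ctl q \<Longrightarrow> (q, dat \<rho>) \<in> W"
      by blast
    obtain a t where t: "\<rho>' = Step \<rho> a (cd t)" "a \<in> set_pmf (\<sigma> \<rho>)"
      "cd t \<in> set_pmf (gtrans Q k s a)" "node t \<rho>'"
      using set_pmf_K[OF s(1) step.hyps(2)] by blast
    show ?case
    proof (cases s)
      case (Ctl q)
      have "a = 0"
        using t(2) s(1) Ctl by (simp add: \<sigma>_def node_def)
      moreover have "q < Q"
        using s(1) Ctl by (simp add: node_def)
      ultimately have "cd t \<in> gsucc Q k q"
        using t(3) Ctl set_pmf_gtrans_Ctl[of q Q k a] by auto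
      then have "(\<exists>q'<Q. t = Ctl q') \<or> (\<exists>i. t = Dsp q i)"
        by auto
      then show ?thesis
        using t(1,4) s(1) s(3)[OF Ctl] U[of q "dat \<rho>"] Ctl
        by (intro exI[of _ t]) (auto simp: dat_def node_def)
    qed (use t s in \<open>auto intro!: exI[of _ t] split: if_splits\<close>)
  qed
  have det: "\<sigma> \<rho> = return_pmf 0" if "last_state \<rho> = cd (Ctl q)" for \<rho> q
    using that by (simp add: \<sigma>_def)
  \<comment> \<open>The bounds in \<open>consistent\<close> make the entries legitimate Bernoulli
    parameters, so the displayed values are the remembered ones.\<close>
  have reg: "reg \<rho> q i = dat \<rho> i" if "(q, dat \<rho>) \<in> W" "i < k" "last_state \<rho> = cd (Ctl q)" for \<rho> q i
  proof -
    have "0 \<le> dat \<rho> i" "dat \<rho> i \<le> 1"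
      using that W(1) by (auto simp: consistent_def)
    moreover have "(\<lambda>b. if b then 1 else (0::nat)) -` {1} = {True}"
      by (auto split: if_splits)
    moreover have "\<sigma> (Step \<rho> 0 (cd (Dsp q i))) =
        map_pmf (\<lambda>b. if b then 1 else 0) (bernoulli_pmf (dat \<rho> i))"
      using that by (simp add: \<sigma>_def dat_def)
    ultimately show ?thesis
      by (simp add: reg_def pmf_map measure_pmf_single)
  qed
  have "sat C \<rho> (gform Q k R)" if re: "\<rho> \<in> mc_reachable C (mc_init C)" for \<rho>
  proof -
    obtain s where s: "node s \<rho>" "s \<noteq> Bad" "\<And>q. s = Ctl q \<Longrightarrow> (q, dat \<rho>) \<in> W"
      using inv[OF re] by blast
    have lab: "mc_label C \<rho> = {cd s}"
      using s(1) by (simp add: node_def induced_mc_def label)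
    have "sat C \<rho> (lform_sform Q k q (R q))" if q: "s = Ctl q" "q < Q" for q
    proof -
      note n = s(1)[unfolded q(1)] and w = s(3)[OF q(1)]
      have last: "last_state \<rho> = cd (Ctl q)"
        using n by (simp add: node_def)
      have child: "dat (Step \<rho> 0 (cd (Ctl q'))) = U q (dat \<rho>) q'" for q'
        using last by (simp add: dat_def)
      have "lform_holds (reg \<rho> q) (\<lambda>q'. reg (Step \<rho> 0 (cd (Ctl q'))) q') (R q) \<longleftrightarrow>
          lform_holds (dat \<rho>) (U q (dat \<rho>)) (R q)"
        using U[OF w] w last by (intro lform_holds_cong[OF ok[OF q(2)]]) (simp_all add: reg child)
      then show ?thesis
        using sat_lform_sform[OF n det[OF last] _ ok[OF q(2)]] U[OF w] det by simp
    qed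
    then show ?thesis
      using lab s(2) by (auto simp: gform_def sat_foldr_Conj)
  qed
  then have "mc_sat_AG C (gform Q k R)"
    by (simp add: mc_sat_AG_def sat_AG_def)
  with strat show ?thesis by blast
qed

lemma gmdp_synthesis_iff:
  assumes q0: "q0 < Q" and ok: "\<And>q. q < Q \<Longrightarrow> lform_ok Q k (R q)"
  shows "encode_instance (gmdp Q k q0) (gform Q k R) \<in> flat_global_window_synthesis \<longleftrightarrow>
    (\<exists>W v. consistent Q k R W \<and> (q0, v) \<in> W)"
proof
  assume "encode_instance (gmdp Q k q0) (gform Q k R) \<in> flat_global_window_synthesis"
  then obtain M \<Phi> \<sigma> where *: "encode_instance (gmdp Q k q0) (gform Q k R) = encode_instance M \<Phi>"
    and M: "input_mdp M" and \<sigma>: "is_strategy M \<sigma>" "mc_sat_AG (induced_mc M \<sigma>) \<Phi>"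
    unfolding flat_global_window_synthesis_def by blast
  have \<Phi>: "\<Phi> = gform Q k R" and eq: "encode_mdp (gmdp Q k q0) = encode_mdp M"
    using * encode_sform_inj by (auto simp: encode_instance_def)
  \<comment> \<open>The witness of membership is merely some MDP with the same code, hence the same
    up to values off its states and actions.\<close>
  note inj = encode_mdp_inj[OF input_mdp_gmdp[OF q0] M eq]
  interpret gadget Q k q0 M \<sigma>
  proof unfold_locales
    fix s a assume s: "s \<in> gstates Q k"
    have "cd s \<in> mdp_states (gmdp Q k q0)"
      using cd_less_gsize[OF s] by (simp add: gmdp_def)
    then show "mdp_label M (cd s) = {cd s}" and "a < 2 \<Longrightarrow> mdp_trans M (cd s) a = gtrans Q k s a"
      using inj(5)[of "cd s" a] inj(6)[of "cd s"] s by (auto simp: gmdp_def)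
  qed (use q0 \<sigma> inj in \<open>auto simp: gmdp_def\<close>)
  show "\<exists>W v. consistent Q k R W \<and> (q0, v) \<in> W"
    using consistent_of_sat ok \<sigma>(2) \<Phi> by blast
next
  assume "\<exists>W v. consistent Q k R W \<and> (q0, v) \<in> W"
  then obtain \<sigma> where "is_strategy (gmdp Q k q0) \<sigma>"
    "mc_sat_AG (induced_mc (gmdp Q k q0) \<sigma>) (gform Q k R)"
    using strategy_of_consistent[where R=R, OF q0 ok] by blast
  moreover have "mdp_AP (gmdp Q k q0) = {..<gsize Q k}"
    by (simp add: gmdp_def)
  ultimately show "encode_instance (gmdp Q k q0) (gform Q k R) \<in> flat_global_window_synthesis"
    unfolding flat_global_window_synthesis_def
    using input_mdp_gmdp[OF q0] gform_wf[where R=R, OF ok]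
    by (intro CollectI exI[of _ "gmdp Q k q0"] exI[of _ "gform Q k R"]) auto
qed

section \<open>Evaluating arithmetical formulas\<close>

text \<open>Constraints have no negation, so formulas are brought into negation normal form:
  membership carries its polarity, and terms are flattened to linear inequalities and products of
  variables.\<close>

datatype nform =
    NLin "(int \<times> nat) list" int
  | NMul nat nat nat
  | NMem bool nat nat
  | NAnd nform nform
  | NOr nform nform
  | NEx nat nform
  | NAll nat nform

primrec nform_holds :: "(nat \<Rightarrow> nat set) \<Rightarrow> (nat \<Rightarrow> nat) \<Rightarrow> nform \<Rightarrow> bool" where
  "nform_holds X e (NLin ts c) \<longleftrightarrow> 0 \<le> c + (\<Sum>(a, i)\<leftarrow>ts. a * int (e i))"
| "nform_holds X e (NMul i j l) \<longleftrightarrow> e i * e j = e l"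
| "nform_holds X e (NMem b i j) \<longleftrightarrow> (e i \<in> X j) = b"
| "nform_holds X e (NAnd \<phi> \<psi>) \<longleftrightarrow> nform_holds X e \<phi> \<and> nform_holds X e \<psi>"
| "nform_holds X e (NOr \<phi> \<psi>) \<longleftrightarrow> nform_holds X e \<phi> \<or> nform_holds X e \<psi>"
| "nform_holds X e (NEx i \<phi>) \<longleftrightarrow> (\<exists>n. nform_holds X (e(i := n)) \<phi>)"
| "nform_holds X e (NAll i \<phi>) \<longleftrightarrow> (\<forall>n. nform_holds X (e(i := n)) \<phi>)"

primrec nform_ok :: "nat \<Rightarrow> nform \<Rightarrow> bool" where
  "nform_ok m (NLin ts c) \<longleftrightarrow> (\<forall>(a, i)\<in>set ts. i < m)"
| "nform_ok m (NMul i j l) \<longleftrightarrow> i < m \<and> j < m \<and> l < m"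
| "nform_ok m (NMem b i j) \<longleftrightarrow> i < m \<and> j < m"
| "nform_ok m (NAnd \<phi> \<psi>) \<longleftrightarrow> nform_ok m \<phi> \<and> nform_ok m \<psi>"
| "nform_ok m (NOr \<phi> \<psi>) \<longleftrightarrow> nform_ok m \<phi> \<and> nform_ok m \<psi>"
| "nform_ok m (NEx i \<phi>) \<longleftrightarrow> i < m \<and> nform_ok m \<phi>"
| "nform_ok m (NAll i \<phi>) \<longleftrightarrow> i < m \<and> nform_ok m \<phi>"

lemma nform_ok_mono: "nform_ok m \<phi> \<Longrightarrow> m \<le> m' \<Longrightarrow> nform_ok m' \<phi>"
  by (induction \<phi>) fastforce+

text \<open>The bound serves number and set variables alike. It is positive so that the input
  variable 0 has a register.\<close>

lemma ex_nform_ok: "\<exists>m>0. nform_ok m \<phi>"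
proof (induction \<phi>)
  case (NLin ts c)
  obtain m where "\<forall>i\<in>snd ` set ts. i < m"
    using finite_nat_set_iff_bounded[of "snd ` set ts"] by auto
  then show ?case by (intro exI[of _ "Suc m"]) fastforce
next
  case (NMul i j l)
  then show ?case by (intro exI[of _ "Suc (i + j + l)"]) auto
next
  case (NMem b i j)
  then show ?case by (intro exI[of _ "Suc (i + j)"]) auto
next
  case (NAnd \<phi> \<psi>)
  then obtain m n where "m > 0" "nform_ok m \<phi>" "nform_ok n \<psi>" by blast
  then show ?case by (intro exI[of _ "m + n"]) (auto elim: nform_ok_mono)
next
  case (NOr \<phi> \<psi>)
  then obtain m n where "m > 0" "nform_ok m \<phi>" "nform_ok n \<psi>" by blast
  then show ?case by (intro exI[of _ "m + n"]) (auto elim: nform_ok_mono)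
next
  case (NEx i \<phi>)
  then obtain m where "nform_ok m \<phi>" by blast
  then show ?case by (intro exI[of _ "Suc (m + i)"]) (auto elim: nform_ok_mono)
next
  case (NAll i \<phi>)
  then obtain m where "nform_ok m \<phi>" by blast
  then show ?case by (intro exI[of _ "Suc (m + i)"]) (auto elim: nform_ok_mono)
qed

primrec subs :: "nform \<Rightarrow> nform set" where
  "subs (NLin ts c) = {NLin ts c}"
| "subs (NMul i j l) = {NMul i j l}"
| "subs (NMem b i j) = {NMem b i j}"
| "subs (NAnd \<phi> \<psi>) = {NAnd \<phi> \<psi>} \<union> subs \<phi> \<union> subs \<psi>"
| "subs (NOr \<phi> \<psi>) = {NOr \<phi> \<psi>} \<union> subs \<phi> \<union> subs \<psi>"
| "subs (NEx i \<phi>) = {NEx i \<phi>} \<union> subs \<phi>"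
| "subs (NAll i \<phi>) = {NAll i \<phi>} \<union> subs \<phi>"

lemma finite_subs [simp]: "finite (subs \<phi>)"
  by (induction \<phi>) auto

lemma subs_refl [simp]: "\<phi> \<in> subs \<phi>"
  by (cases \<phi>) auto

lemma subs_trans: "\<psi> \<in> subs \<phi> \<Longrightarrow> subs \<psi> \<subseteq> subs \<phi>"
  by (induction \<phi>) auto

lemma nform_ok_subs: "nform_ok m \<phi> \<Longrightarrow> \<psi> \<in> subs \<phi> \<Longrightarrow> nform_ok m \<psi>"
  by (induction \<phi>) auto

section \<open>Locations, registers and rules\<close>

text \<open>At \<open>Main \<psi>\<close> the formula \<open>\<psi>\<close> is claimed to hold;
  \<open>Loop \<psi>\<close> counts through the values of the variable quantified by
  \<open>\<psi>\<close>. \<open>MulL\<close> and \<open>MemL\<close> are countdowns shared by all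
  multiplication and membership claims.\<close>

datatype loc = Init | Main nform | Loop nform | MulL | MemL

instance nform :: countable
  by countable_datatype

instance loc :: countable
  by countable_datatype

abbreviation lc :: "loc \<Rightarrow> nat" where
  "lc \<equiv> to_nat"

text \<open>Register 0 holds the unit, \<open>ereg i\<close> the number variable \<open>i\<close> and \<open>sreg j\<close> the set variable \<open>j\<close>.
  Registers 1 to 4 are auxiliary.  A vector with unit 0 is idle: it satisfies every rule but the
  initial one, and is passed to the children that are not needed.\<close>

definition ereg :: "nat \<Rightarrow> nat" where "ereg i = 5 + 2 * i"
definition sreg :: "nat \<Rightarrow> nat" where "sreg j = 6 + 2 * j"
definition nreg :: "nat \<Rightarrow> nat" where "nreg m = 5 + 2 * m"

lemma reg_simps [simp]:
  "ereg i = ereg j \<longleftrightarrow> i = j" "sreg i \<noteq> ereg j"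
  "ereg i \<noteq> 0" "ereg i \<noteq> Suc 0" "sreg i \<noteq> Suc 0" "sreg i \<noteq> 0"
  "ereg i < nreg m \<longleftrightarrow> i < m" "i < m \<Longrightarrow> sreg i < nreg m"
  "0 < nreg m" "Suc 0 < nreg m" "2 < nreg m" "3 < nreg m" "4 < nreg m"
  by (auto simp: ereg_def sreg_def nreg_def) presburger+

text \<open>The term with coefficient 0 keeps the list nonempty, as \<open>lform_ok\<close>
  demands.\<close>

definition ltrue :: lform where
  "ltrue = Lin [(0, Cur 0)] GEq"

definition lands :: "lform list \<Rightarrow> lform" where
  "lands fs = foldr LAnd fs ltrue"

definition lzero :: "(int \<times> lvar) list \<Rightarrow> lform" where
  "lzero ts = LAnd (Lin ts GEq) (Lin (map (\<lambda>(c, x). (- c, x)) ts) GEq)"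

lemma lform_holds_ltrue [simp]: "lform_holds v u ltrue"
  by (simp add: ltrue_def)

lemma lform_holds_lands [simp]: "lform_holds v u (lands fs) \<longleftrightarrow> (\<forall>f\<in>set fs. lform_holds v u f)"
  unfolding lands_def by (induction fs) auto

lemma lform_holds_lzero [simp]:
  "lform_holds v u (lzero ts) \<longleftrightarrow> (\<Sum>(c, x)\<leftarrow>ts. real_of_int c * lvar_val v u x) = 0"
proof -
  have "(\<Sum>(c, x)\<leftarrow>map (\<lambda>(c, x). (- c, x)) ts. real_of_int c * lvar_val v u x) =
      - (\<Sum>(c, x)\<leftarrow>ts. real_of_int c * lvar_val v u x)"
    by (induction ts) auto
  then show ?thesis by (simp add: lzero_def) linarith
qed

lemma lform_ok_ltrue [simp]: "lform_ok Q k ltrue \<longleftrightarrow> 0 < k"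
  by (simp add: ltrue_def)

lemma lform_ok_lands: "0 < k \<Longrightarrow> lform_ok Q k (lands fs) \<longleftrightarrow> (\<forall>f\<in>set fs. lform_ok Q k f)"
  unfolding lands_def by (induction fs) auto

lemma lform_ok_lzero [simp]:
  "lform_ok Q k (lzero ts) \<longleftrightarrow> ts \<noteq> [] \<and> (\<forall>(c, x)\<in>set ts. lvar_ok Q k x)"
  by (auto simp: lzero_def)

definition lcopy :: "nat \<Rightarrow> loc \<Rightarrow> lform" where
  "lcopy k l = lands (map (\<lambda>r. lzero [(1, Chd (lc l) r), (-1, Cur r)]) [0..<k])"

text \<open>Register 1 is left open, since an existential loop receives its guess there.\<close>

definition lenter :: "nat \<Rightarrow> nat \<Rightarrow> loc \<Rightarrow> lform" where
  "lenter k i l = lands (lzero [(1, Chd (lc l) (ereg i))] #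
     map (\<lambda>r. lzero [(1, Chd (lc l) r), (-1, Cur r)]) (filter (\<lambda>r. r \<noteq> 1 \<and> r \<noteq> ereg i) [0..<k]))"

text \<open>Halving all registers keeps the incremented one in the unit interval.\<close>

definition lstep :: "nat \<Rightarrow> nat \<Rightarrow> loc \<Rightarrow> lform" where
  "lstep k i l = lands (lzero [(2, Chd (lc l) (ereg i)), (-1, Cur (ereg i)), (-1, Cur 0)] #
     map (\<lambda>r. lzero [(2, Chd (lc l) r), (-1, Cur r)]) (filter (\<lambda>r. r \<noteq> 1 \<and> r \<noteq> ereg i) [0..<k]))"

lemma lform_holds_lcopy [simp]:
  "lform_holds v u (lcopy k l) \<longleftrightarrow> (\<forall>r<k. u (lc l) r = v r)"
  by (auto simp: lcopy_def)

lemma lform_holds_lenter [simp]: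
  "lform_holds v u (lenter k i l) \<longleftrightarrow> u (lc l) (ereg i) = 0 \<and>
     (\<forall>r<k. r \<noteq> 1 \<longrightarrow> r \<noteq> ereg i \<longrightarrow> u (lc l) r = v r)"
  by (auto simp: lenter_def)

lemma lform_holds_lstep [simp]:
  "lform_holds v u (lstep k i l) \<longleftrightarrow> 2 * u (lc l) (ereg i) = v (ereg i) + v 0 \<and>
     (\<forall>r<k. r \<noteq> 1 \<longrightarrow> r \<noteq> ereg i \<longrightarrow> 2 * u (lc l) r = v r)"
  by (auto simp: lstep_def)

text \<open>Register 1 of a loop for an existential quantifier is the guess that bounds its length.\<close>

fun loc_rule :: "nat \<Rightarrow> loc \<Rightarrow> lform" where
  "loc_rule k (Main (NLin ts c)) = Lin ((c, Cur 0) # map (\<lambda>(a, i). (a, Cur (ereg i))) ts) GEq"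
| "loc_rule k (Main (NMul i j l)) = lands
     [lzero [(1, Chd (lc MulL) 0), (-1, Cur 0)],
      lzero [(1, Chd (lc MulL) 2), (-1, Cur (ereg i))],
      lzero [(1, Chd (lc MulL) 3), (-1, Cur (ereg l))],
      lzero [(1, Chd (lc MulL) 4), (-1, Cur (ereg j))]]"
| "loc_rule k (Main (NMem b i j)) = lands
     [lzero [(1, Chd (lc MemL) 0), (-1, Cur 0)],
      lzero [(1, Chd (lc MemL) 2), (-1, Cur (ereg i))],
      lzero [(1, Chd (lc MemL) 3), (-1, Cur (sreg j))],
      lzero [(1, Chd (lc MemL) 4), (if b then -1 else 0, Cur 0)]]"
| "loc_rule k (Main (NAnd \<phi> \<psi>)) = LAnd (lcopy k (Main \<phi>)) (lcopy k (Main \<psi>))"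
| "loc_rule k (Main (NOr \<phi> \<psi>)) = LOr (lcopy k (Main \<phi>)) (lcopy k (Main \<psi>))"
| "loc_rule k (Main (NEx i \<phi>)) =
     LAnd (lenter k i (Loop (NEx i \<phi>))) (Lin [(1, Chd (lc (Loop (NEx i \<phi>))) 1)] Gr)"
| "loc_rule k (Main (NAll i \<phi>)) = lenter k i (Loop (NAll i \<phi>))"
| "loc_rule k (Loop (NEx i \<phi>)) = LOr (lcopy k (Main \<phi>))
     (LAnd (lstep k i (Loop (NEx i \<phi>))) (lzero [(1, Chd (lc (Loop (NEx i \<phi>))) 1), (-2, Cur 1)]))"
| "loc_rule k (Loop (NAll i \<phi>)) = LAnd (lcopy k (Main \<phi>)) (lstep k i (Loop (NAll i \<phi>)))"
| "loc_rule k MulL = LOr (LAnd (lzero [(1, Cur 2)]) (lzero [(1, Cur 3)])) (lands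
     [lzero [(1, Chd (lc MulL) 0), (-1, Cur 0)],
      lzero [(1, Chd (lc MulL) 4), (-1, Cur 4)],
      lzero [(1, Chd (lc MulL) 2), (-1, Cur 2), (1, Cur 0)],
      lzero [(1, Chd (lc MulL) 3), (-1, Cur 3), (1, Cur 4)]])"
| "loc_rule k MemL = LOr
     (LAnd (lzero [(1, Cur 2)])
       (LOr (LAnd (lzero [(1, Cur 4), (-1, Cur 0)]) (Lin [(3, Cur 3), (-1, Cur 0)] GEq))
            (LAnd (lzero [(1, Cur 4)]) (Lin [(1, Cur 0), (-3, Cur 3)] Gr))))
     (lands
       [lzero [(1, Chd (lc MemL) 0), (-1, Cur 0)],
        lzero [(1, Chd (lc MemL) 4), (-1, Cur 4)],
        lzero [(1, Chd (lc MemL) 2), (-1, Cur 2), (1, Cur 0)],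
        LOr (LAnd (Lin [(3, Cur 3), (-1, Cur 0)] GEq)
                  (lzero [(1, Chd (lc MemL) 3), (-3, Cur 3), (1, Cur 0)]))
            (LAnd (Lin [(1, Cur 0), (-3, Cur 3)] Gr)
                  (lzero [(1, Chd (lc MemL) 3), (-3, Cur 3)]))])"
| "loc_rule k _ = ltrue"

definition locs :: "nform \<Rightarrow> loc set" where
  "locs \<phi> = {Init, MulL, MemL} \<union> Main ` subs \<phi> \<union> Loop ` subs \<phi>"

definition nlocs :: "nform \<Rightarrow> nat" where
  "nlocs \<phi> = Suc (Max (lc ` locs \<phi>))"

lemma lc_less_nlocs: "l \<in> locs \<phi> \<Longrightarrow> lc l < nlocs \<phi>"
  unfolding nlocs_def less_Suc_eq_le by (intro Max_ge) (auto simp: locs_def)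

lemma locs_simps [simp]:
  "Init \<in> locs \<phi>" "MulL \<in> locs \<phi>" "MemL \<in> locs \<phi>" "Main \<psi> \<in> locs \<phi> \<longleftrightarrow> \<psi> \<in> subs \<phi>"
  "Loop \<psi> \<in> locs \<phi> \<longleftrightarrow> \<psi> \<in> subs \<phi>"
  by (auto simp: locs_def)

text \<open>The coefficient \<open>- 1 - int x\<close> is never nonnegative, which makes its code \<open>2 * x + 1\<close> for all \<open>x\<close>.\<close>

definition init_rule :: "nat \<Rightarrow> nform \<Rightarrow> nat \<Rightarrow> lform" where
  "init_rule m \<phi> x = LAnd
     (LAnd (Lin [(int x, Cur 0), (-1, Cur (ereg 0))] GEq)
           (Lin [(-1 - int x, Cur 0), (1, Cur 0), (1, Cur (ereg 0))] GEq))
     (lands (Lin [(1, Cur 0)] Gr # lcopy (nreg m) (Main \<phi>) #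
        map (\<lambda>i. lzero [(1, Cur (ereg i))]) [1..<m]))"

text \<open>The first disjunct admits idle vectors: with entries in the unit interval it says that
  the unit is 0. Numbers below \<open>nlocs \<phi>\<close> that are not codes of locations get a
  trivial rule.\<close>

definition nform_rule :: "nat \<Rightarrow> nform \<Rightarrow> nat \<Rightarrow> nat \<Rightarrow> lform" where
  "nform_rule m \<phi> x q = (let l = from_nat q in
     if l = Init then init_rule m \<phi> x
     else if l \<in> locs \<phi> then LOr (Lin [(-1, Cur 0)] GEq) (loc_rule (nreg m) l)
     else ltrue)"

lemma lform_ok_nform_rule:
  assumes ok: "nform_ok m \<phi>" and m: "m > 0"
  shows "lform_ok (nlocs \<phi>) (nreg m) (nform_rule m \<phi> x q)"
proof -
  let ?ok = "lform_ok (nlocs \<phi>) (nreg m)"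
  have copy: "?ok (lcopy (nreg m) l)" if "l \<in> locs \<phi>" for l
    using lc_less_nlocs[OF that] by (auto simp: lcopy_def lform_ok_lands)
  have enter: "?ok (lenter (nreg m) i l)" "?ok (lstep (nreg m) i l)" if "l \<in> locs \<phi>" "i < m" for l i
    using lc_less_nlocs[OF that(1)] that(2) by (auto simp: lenter_def lstep_def lform_ok_lands)
  have sub: "nform_ok m \<psi>" "subs \<psi> \<subseteq> subs \<phi>" if "\<psi> \<in> subs \<phi>" for \<psi>
    using that nform_ok_subs[OF ok] subs_trans by auto
  have "?ok (init_rule m \<phi> x)"
    using m by (auto simp: init_rule_def lform_ok_lands copy)
  moreover have "?ok (loc_rule (nreg m) l)" if l: "l \<in> locs \<phi>" for l
  proof (cases l)
    case (Main \<psi>)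
    with l have \<psi>: "\<psi> \<in> subs \<phi>" by simp
    show ?thesis
      using sub[OF \<psi>] \<psi> unfolding Main
      by (cases \<psi>) (auto simp: lform_ok_lands lc_less_nlocs intro!: copy enter dest: subsetD[OF _ subs_refl] dest!: bspec)
  next
    case (Loop \<psi>)
    with l have \<psi>: "\<psi> \<in> subs \<phi>" by simp
    show ?thesis
      using sub[OF \<psi>] \<psi> unfolding Loop
      by (cases \<psi>) (auto simp: lform_ok_lands lc_less_nlocs intro!: copy enter dest: subsetD[OF _ subs_refl] dest!: bspec)
  qed (auto simp: lform_ok_lands lc_less_nlocs)
  ultimately show ?thesis
    by (simp add: nform_rule_def Let_def)
qed

section \<open>Numbers and sets relative to a unit\<close>

text \<open>Everything is measured in the unit \<open>v 0\<close>, so scaling a vector by a positive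
  factor keeps what it encodes. The ratios \<open>r\<close> may be any reals.\<close>

definition encodes :: "nat \<Rightarrow> (nat \<Rightarrow> real) \<Rightarrow> (nat \<Rightarrow> nat) \<Rightarrow> (nat \<Rightarrow> real) \<Rightarrow> bool" where
  "encodes m r e v \<longleftrightarrow> v 0 > 0 \<and> (\<forall>i<m. v (ereg i) = real (e i) * v 0) \<and>
     (\<forall>j<m. v (sreg j) = r j * v 0)"

lemma encodes_copy:
  assumes "encodes m r e v" "\<forall>q<nreg m. v' q = v q"
  shows "encodes m r e v'"
  using assms by (simp add: encodes_def)

lemma encodes_enter:
  assumes "encodes m r e v" "v' (ereg i) = 0" "\<forall>q<nreg m. q \<noteq> 1 \<longrightarrow> q \<noteq> ereg i \<longrightarrow> v' q = v q"
  shows "encodes m r (e(i := 0)) v'"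
  using assms by (simp add: encodes_def)

text \<open>Halving acts on the unit as well, so ratios to it are kept; adding \<open>v 0\<close>
  before halving raises \<open>ereg i\<close> by one unit.\<close>

lemma encodes_step:
  assumes "encodes m r e v" "2 * v' (ereg i) = v (ereg i) + v 0"
    "\<forall>q<nreg m. q \<noteq> 1 \<longrightarrow> q \<noteq> ereg i \<longrightarrow> 2 * v' q = v q"
  shows "encodes m r (e(i := Suc (e i))) v'"
proof -
  have eq: "v 0 = 2 * v' 0" "v (ereg i) = 2 * v' (ereg i) - 2 * v' 0"
    using assms(2) assms(3)[rule_format, of 0] by auto
  have "v' (ereg j) = real (e j) * v' 0" if "j < m" "j \<noteq> i" for j
    using assms(1) assms(3)[rule_format, of "ereg j"] eq(1) that by (simp add: encodes_def)
  moreover have "v' (sreg j) = r j * v' 0" if "j < m" for j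
    using assms(1) assms(3)[rule_format, of "sreg j"] eq(1) that by (simp add: encodes_def)
  moreover have "v' (ereg i) = real (Suc (e i)) * v' 0" if "i < m"
    using assms(1) eq that by (auto simp: encodes_def algebra_simps)
  ultimately show ?thesis
    using assms(1) eq(1) by (auto simp: encodes_def)
qed

lemma encodes_NLin:
  assumes "encodes m r e v" "nform_ok m (NLin ts c)"
  shows "lform_holds v u (loc_rule k (Main (NLin ts c))) \<longleftrightarrow> nform_holds X e (NLin ts c)"
proof -
  have "(\<Sum>(c, x)\<leftarrow>map (\<lambda>(a, i). (a, Cur (ereg i))) ts. real_of_int c * lvar_val v u x) =
      real_of_int (\<Sum>(a, i)\<leftarrow>ts. a * int (e i)) * v 0"
    using assms by (induction ts) (auto simp: encodes_def algebra_simps)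
  then have "lform_holds v u (loc_rule k (Main (NLin ts c))) \<longleftrightarrow>
      0 \<le> real_of_int (c + (\<Sum>(a, i)\<leftarrow>ts. a * int (e i))) * v 0"
    by (simp add: algebra_simps)
  also have "\<dots> \<longleftrightarrow> nform_holds X e (NLin ts c)"
    using assms(1) by (simp add: encodes_def zero_le_mult_iff del: of_int_add)
  finally show ?thesis .
qed

text \<open>Test and shift make sense for every real, so \<open>digits3\<close> assigns a set to
  whatever real a strategy guesses. Soundness therefore does not require the guess to be a proper
  code.\<close>

definition shift3 :: "real \<Rightarrow> real" where
  "shift3 r = (if 3 * r \<ge> 1 then 3 * r - 1 else 3 * r)"

definition digits3 :: "real \<Rightarrow> nat set" where
  "digits3 r = {n. 3 * (shift3 ^^ n) r \<ge> 1}"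

lemma digits3_0: "0 \<in> digits3 r \<longleftrightarrow> 3 * r \<ge> 1"
  by (simp add: digits3_def)

lemma digits3_Suc: "Suc n \<in> digits3 r \<longleftrightarrow> n \<in> digits3 (shift3 r)"
  by (simp add: digits3_def funpow_swap1)

section \<open>Soundness: claims in a consistent set are true\<close>

context
  fixes m x :: nat and \<phi> :: nform and W
  assumes ok: "nform_ok m \<phi>"
    and W: "consistent (nlocs \<phi>) (nreg m) (nform_rule m \<phi> x) W"
begin

lemma W_bounds: "(q, v) \<in> W \<Longrightarrow> r < nreg m \<Longrightarrow> 0 \<le> v r" "(q, v) \<in> W \<Longrightarrow> r < nreg m \<Longrightarrow> v r \<le> 1"
  using W by (auto simp: consistent_def)

lemma W_step:
  assumes "(lc l, v) \<in> W" "l \<in> locs \<phi>" "l \<noteq> Init" "v 0 > 0"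
  obtains u where "\<And>l'. l' \<in> locs \<phi> \<Longrightarrow> (lc l', u (lc l')) \<in> W"
    "lform_holds v u (loc_rule (nreg m) l)"
proof -
  obtain u where "\<forall>q'<nlocs \<phi>. (q', u q') \<in> W" "lform_holds v u (nform_rule m \<phi> x (lc l))"
    using W assms(1) by (fastforce simp: consistent_def)
  then show ?thesis
    using assms lc_less_nlocs by (intro that[of u]) (auto simp: nform_rule_def)
qed

lemma W_step_Main:
  assumes "(lc (Main \<psi>), v) \<in> W" "\<psi> \<in> subs \<phi>" "v 0 > 0"
  obtains u where "\<And>l'. l' \<in> locs \<phi> \<Longrightarrow> (lc l', u (lc l')) \<in> W"
    "lform_holds v u (loc_rule (nreg m) (Main \<psi>))"
  by (rule W_step[OF assms(1)]) (use assms(2,3) that in auto)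

lemma W_step_Loop:
  assumes "(lc (Loop \<psi>), v) \<in> W" "\<psi> \<in> subs \<phi>" "v 0 > 0"
  obtains u where "\<And>l'. l' \<in> locs \<phi> \<Longrightarrow> (lc l', u (lc l')) \<in> W"
    "lform_holds v u (loc_rule (nreg m) (Loop \<psi>))"
  by (rule W_step[OF assms(1)]) (use assms(2,3) that in auto)

text \<open>Each round subtracts the unit from register 2 and register 4 from register 3, and the
  branch may stop only when registers 2 and 3 both vanish. Nonnegativity of register 2 bounds the
  number of rounds, and that number is the common factor \<open>n\<close>.\<close>

lemma MulL_sound:
  assumes "(lc MulL, v) \<in> W" "v 0 > 0"
  shows "\<exists>n. v 2 = real n * v 0 \<and> v 3 = real n * v 4"
proof -
  obtain N where "v 2 / v 0 \<le> real N"
    using real_arch_simple by blast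
  then have "v 2 \<le> real N * v 0"
    using assms(2) by (simp add: field_simps)
  with assms show ?thesis
  proof (induction N arbitrary: v)
    case 0
    obtain u where u: "(lc MulL, u (lc MulL)) \<in> W" "lform_holds v u (loc_rule (nreg m) MulL)"
      using W_step[OF 0(1)] 0(2) by (metis loc.distinct(5) locs_simps(2))
    \<comment> \<open>Another round would make register 2 of the child negative, so the stopping
      disjunct holds.\<close>
    have "0 \<le> u (lc MulL) 2" "0 \<le> v 2"
      using W_bounds(1)[OF u(1)] W_bounds(1)[OF 0(1)] by auto
    with u(2) 0 show ?case
      by (intro exI[of _ 0]) auto
  next
    case (Suc N)
    obtain u where u: "(lc MulL, u (lc MulL)) \<in> W" "lform_holds v u (loc_rule (nreg m) MulL)"
      using W_step[OF Suc.prems(1)] Suc.prems(2) by (metis loc.distinct(5) locs_simps(2))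
    from u(2) consider "v 2 = 0" "v 3 = 0" | "u (lc MulL) 0 = v 0" "u (lc MulL) 4 = v 4"
      "u (lc MulL) 2 = v 2 - v 0" "u (lc MulL) 3 = v 3 - v 4"
      by force
    then show ?case
    proof cases
      case 1
      then show ?thesis by (intro exI[of _ 0]) auto
    next
      case 2
      have "\<exists>n. u (lc MulL) 2 = real n * u (lc MulL) 0 \<and> u (lc MulL) 3 = real n * u (lc MulL) 4"
        using Suc.prems 2 by (intro Suc.IH[OF u(1)]) (auto simp: algebra_simps)
      then obtain n where "v 2 - v 0 = real n * v 0" "v 3 - v 4 = real n * v 4"
        using 2 by auto
      then show ?thesis by (intro exI[of _ "Suc n"]) (simp add: algebra_simps)
    qed
  qed
qed

text \<open>The same countdown on register 2, while register 3 loses one leading base-3 digit per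
  round. When it stops, the current digit must agree with the announced answer in register 4: the
  unit for membership, 0 otherwise.\<close>

lemma MemL_sound:
  assumes "(lc MemL, v) \<in> W" "v 0 > 0"
  shows "\<exists>n. v 2 = real n * v 0 \<and> v 4 = (if n \<in> digits3 (v 3 / v 0) then v 0 else 0)"
proof -
  obtain N where "v 2 / v 0 \<le> real N"
    using real_arch_simple by blast
  then have "v 2 < real (Suc N) * v 0"
    using assms(2) by (simp add: field_simps)
  moreover have "\<exists>n. v 2 = real n * v 0 \<and> v 4 = (if n \<in> digits3 (v 3 / v 0) then v 0 else 0)"
    if "(lc MemL, v) \<in> W" "v 0 > 0" "v 2 < real N * v 0" for v N
    using that
  proof (induction N arbitrary: v)
    case 0
    then show ?case
      using W_bounds(1)[OF 0(1), of 2] by simp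
  next
    case (Suc N)
    obtain u where u: "(lc MemL, u (lc MemL)) \<in> W" "lform_holds v u (loc_rule (nreg m) MemL)"
      using W_step[OF Suc.prems(1)] Suc.prems(2) by (metis loc.distinct(7) locs_simps(3))
    have digit: "3 * (v 3 / v 0) \<ge> 1 \<longleftrightarrow> 3 * v 3 \<ge> v 0"
      using Suc.prems(2) by (simp add: field_simps)
    from u(2) consider "v 2 = 0" "v 4 = v 0" "3 * v 3 \<ge> v 0" | "v 2 = 0" "v 4 = 0" "3 * v 3 < v 0"
      | "u (lc MemL) 0 = v 0" "u (lc MemL) 4 = v 4" "u (lc MemL) 2 = v 2 - v 0"
        "u (lc MemL) 3 = (if 3 * v 3 \<ge> v 0 then 3 * v 3 - v 0 else 3 * v 3)"
      by (auto simp: algebra_simps)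
    then show ?case
    proof cases
      case 3
      have "\<exists>n. u (lc MemL) 2 = real n * u (lc MemL) 0 \<and>
          u (lc MemL) 4 = (if n \<in> digits3 (u (lc MemL) 3 / u (lc MemL) 0) then u (lc MemL) 0 else 0)"
        using Suc.prems 3 by (intro Suc.IH[OF u(1)]) (auto simp: algebra_simps)
      moreover have "u (lc MemL) 3 / u (lc MemL) 0 = shift3 (v 3 / v 0)"
        using 3 Suc.prems(2) unfolding shift3_def digit by (simp add: diff_divide_distrib)
      ultimately obtain n where "u (lc MemL) 2 = real n * u (lc MemL) 0"
          "u (lc MemL) 4 = (if n \<in> digits3 (shift3 (v 3 / v 0)) then u (lc MemL) 0 else 0)"
        by metis
      then have "v 2 - v 0 = real n * v 0"
          "v 4 = (if n \<in> digits3 (shift3 (v 3 / v 0)) then v 0 else 0)"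
        by (simp_all only: 3)
      then show ?thesis
        by (intro exI[of _ "Suc n"]) (simp add: algebra_simps digits3_Suc)
    qed (auto intro!: exI[of _ 0] simp: digits3_0 digit simp del: times_divide_eq_right)
  qed
  ultimately show ?thesis
    using assms by blast
qed

lemma Main_sound:
  assumes "(lc (Main \<psi>), v) \<in> W" "subs \<psi> \<subseteq> subs \<phi>" "encodes m r e v"
  shows "nform_holds (\<lambda>j. digits3 (r j)) e \<psi>"
  using assms
proof (induction \<psi> arbitrary: v e)
  case (NLin ts c)
  have "nform_ok m (NLin ts c)"
    using NLin.prems(2) nform_ok_subs[OF ok, of "NLin ts c"] by auto
  moreover have "NLin ts c \<in> subs \<phi>" "v 0 > 0"
    using NLin.prems by (auto simp: encodes_def)
  then obtain u where "lform_holds v u (loc_rule (nreg m) (Main (NLin ts c)))"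
    by (rule W_step_Main[OF NLin.prems(1)])
  ultimately show ?case
    using encodes_NLin[OF NLin.prems(3)] by blast
next
  case (NMul i j l)
  have ijl: "i < m" "j < m" "l < m"
    using NMul.prems(2) nform_ok_subs[OF ok, of "NMul i j l"] by auto
  have "NMul i j l \<in> subs \<phi>" "v 0 > 0"
    using NMul.prems by (auto simp: encodes_def)
  then obtain u where u: "(lc MulL, u (lc MulL)) \<in> W"
    "lform_holds v u (loc_rule (nreg m) (Main (NMul i j l)))"
    using W_step_Main[OF NMul.prems(1)] locs_simps(2) by metis
  have v: "v 0 > 0" "v (ereg i) = real (e i) * v 0" "v (ereg j) = real (e j) * v 0"
    "v (ereg l) = real (e l) * v 0"
    using NMul.prems(3) ijl by (auto simp: encodes_def)
  obtain n where "v (ereg i) = real n * v 0" "v (ereg l) = real n * v (ereg j)"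
    using MulL_sound[OF u(1)] u(2) v(1) by auto
  then have "real (e l) = real (e i * e j)"
    using v by simp
  then show ?case
    by (simp only: of_nat_eq_iff nform_holds.simps)
next
  case (NMem b i j)
  have ij: "i < m" "j < m"
    using NMem.prems(2) nform_ok_subs[OF ok, of "NMem b i j"] by auto
  have "NMem b i j \<in> subs \<phi>" "v 0 > 0"
    using NMem.prems by (auto simp: encodes_def)
  then obtain u where u: "(lc MemL, u (lc MemL)) \<in> W"
    "lform_holds v u (loc_rule (nreg m) (Main (NMem b i j)))"
    using W_step_Main[OF NMem.prems(1)] locs_simps(3) by metis
  have v: "v 0 > 0" "v (ereg i) = real (e i) * v 0" "v (sreg j) = r j * v 0"
    using NMem.prems(3) ij by (auto simp: encodes_def)
  \<comment> \<open>The rule enters the countdown with the answer prescribed by the polarity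
    \<open>b\<close>, and the countdown confirms the actual one.\<close>
  obtain n where "v (ereg i) = real n * v 0"
    "(if b then v 0 else 0) = (if n \<in> digits3 (v (sreg j) / v 0) then v 0 else 0)"
    using MemL_sound[OF u(1)] u(2) v(1) by (auto split: if_splits)
  then show ?case
    using v by (auto split: if_splits)
next
  case (NAnd \<psi>1 \<psi>2)
  have "v 0 > 0" "\<psi>1 \<in> subs \<phi>" "\<psi>2 \<in> subs \<phi>" "NAnd \<psi>1 \<psi>2 \<in> subs \<phi>"
    using NAnd.prems by (auto simp: encodes_def)
  then obtain u where u: "(lc (Main \<psi>1), u (lc (Main \<psi>1))) \<in> W" "(lc (Main \<psi>2), u (lc (Main \<psi>2))) \<in> W"
    "lform_holds v u (loc_rule (nreg m) (Main (NAnd \<psi>1 \<psi>2)))"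
    using W_step_Main[OF NAnd.prems(1)] locs_simps(4) by metis
  then show ?case
    using NAnd.prems NAnd.IH(1)[OF u(1)] NAnd.IH(2)[OF u(2)] by (auto intro: encodes_copy)
next
  case (NOr \<psi>1 \<psi>2)
  have "v 0 > 0" "\<psi>1 \<in> subs \<phi>" "\<psi>2 \<in> subs \<phi>" "NOr \<psi>1 \<psi>2 \<in> subs \<phi>"
    using NOr.prems by (auto simp: encodes_def)
  then obtain u where u: "(lc (Main \<psi>1), u (lc (Main \<psi>1))) \<in> W" "(lc (Main \<psi>2), u (lc (Main \<psi>2))) \<in> W"
    "lform_holds v u (loc_rule (nreg m) (Main (NOr \<psi>1 \<psi>2)))"
    using W_step_Main[OF NOr.prems(1)] locs_simps(4) by metis
  then show ?case
    using NOr.prems NOr.IH(1)[OF u(1)] NOr.IH(2)[OF u(2)] by (auto intro: encodes_copy)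
next
  case (NEx i \<psi>)
  let ?L = "Loop (NEx i \<psi>)"
  have sub: "\<psi> \<in> subs \<phi>" "NEx i \<psi> \<in> subs \<phi>" "subs \<psi> \<subseteq> subs \<phi>" and "v 0 > 0"
    using NEx.prems by (auto simp: encodes_def)
  \<comment> \<open>The guess in register 1 doubles with every round and stays at most 1. The
    exponent \<open>N\<close> therefore bounds the rounds before the loop must leave for
    \<open>Main \<psi>\<close>.\<close>
  have loop: "\<exists>n. nform_holds (\<lambda>j. digits3 (r j)) (e(i := n)) \<psi>"
    if "(lc ?L, v) \<in> W" "encodes m r e v" "v 1 > 0" "1 < v 1 * 2 ^ N" for v e N
    using that
  proof (induction N arbitrary: v e)
    case 0
    then show ?case
      using W_bounds(2)[OF 0(1), of 1] by simp
  next
    case (Suc N)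
    obtain u where u: "(lc (Main \<psi>), u (lc (Main \<psi>))) \<in> W" "(lc ?L, u (lc ?L)) \<in> W"
      "lform_holds v u (loc_rule (nreg m) ?L)"
      using W_step_Loop[OF Suc.prems(1) sub(2)] Suc.prems(2) sub locs_simps(4,5) unfolding encodes_def by metis
    from u(3) consider "\<forall>q<nreg m. u (lc (Main \<psi>)) q = v q"
      | "lform_holds v u (lstep (nreg m) i ?L)" "u (lc ?L) 1 = 2 * v 1"
      by auto
    then show ?case
    proof cases
      case 1
      then have "nform_holds (\<lambda>j. digits3 (r j)) e \<psi>"
        using NEx.IH[OF u(1) sub(3)] Suc.prems(2) encodes_copy by blast
      then show ?thesis by (metis fun_upd_triv)
    next
      case 2
      have "\<exists>n. nform_holds (\<lambda>j. digits3 (r j)) (e(i := Suc (e i), i := n)) \<psi>"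
        using Suc.prems 2 by (intro Suc.IH[OF u(2)] encodes_step[OF Suc.prems(2)]) auto
      then show ?thesis by (simp only: fun_upd_upd)
    qed
  qed
  obtain u where u: "(lc ?L, u (lc ?L)) \<in> W" "lform_holds v u (loc_rule (nreg m) (Main (NEx i \<psi>)))"
    using W_step_Main[OF NEx.prems(1) sub(2) \<open>v 0 > 0\<close>] sub locs_simps(5) by metis
  have pos: "u (lc ?L) 1 > 0" and enc: "encodes m r (e(i := 0)) (u (lc ?L))"
    using u(2) encodes_enter[OF NEx.prems(3)] by auto
  obtain N where "1 / u (lc ?L) 1 < 2 ^ N"
    using real_arch_pow[of 2 "1 / u (lc ?L) 1"] by auto
  then have "1 < u (lc ?L) 1 * 2 ^ N"
    using pos by (simp add: field_simps)
  from loop[OF u(1) enc pos this] show ?case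
    by (simp only: fun_upd_upd nform_holds.simps)
next
  case (NAll i \<psi>)
  let ?L = "Loop (NAll i \<psi>)"
  have sub: "\<psi> \<in> subs \<phi>" "NAll i \<psi> \<in> subs \<phi>" "subs \<psi> \<subseteq> subs \<phi>" and "v 0 > 0"
    using NAll.prems by (auto simp: encodes_def)
  \<comment> \<open>Every round both checks the body at the current value and goes on, so the value
    \<open>e i + n\<close> is checked after \<open>n\<close> rounds.\<close>
  have loop: "nform_holds (\<lambda>j. digits3 (r j)) (e(i := e i + n)) \<psi>"
    if "(lc ?L, v) \<in> W" "encodes m r e v" for v e n
    using that
  proof (induction n arbitrary: v e)
    case 0
    obtain u where u: "(lc (Main \<psi>), u (lc (Main \<psi>))) \<in> W" "lform_holds v u (loc_rule (nreg m) ?L)"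
      using W_step_Loop[OF 0(1) sub(2)] 0(2) sub locs_simps(4,5) unfolding encodes_def by metis
    then have "nform_holds (\<lambda>j. digits3 (r j)) e \<psi>"
      using NAll.IH[OF u(1) sub(3)] encodes_copy[OF 0(2)] by auto
    then show ?case by simp
  next
    case (Suc n)
    obtain u where u: "(lc ?L, u (lc ?L)) \<in> W" "lform_holds v u (loc_rule (nreg m) ?L)"
      using W_step_Loop[OF Suc.prems(1) sub(2)] Suc.prems(2) sub locs_simps(4,5) unfolding encodes_def by metis
    have "encodes m r (e(i := Suc (e i))) (u (lc ?L))"
      using u(2) by (intro encodes_step[OF Suc.prems(2)]) auto
    from Suc.IH[OF u(1) this] show ?case
      by (simp only: fun_upd_upd fun_upd_same add_Suc_shift)
  qed
  obtain u where u: "(lc ?L, u (lc ?L)) \<in> W" "lform_holds v u (loc_rule (nreg m) (Main (NAll i \<psi>)))"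
    using W_step_Main[OF NAll.prems(1) sub(2) \<open>v 0 > 0\<close>] sub locs_simps(5) by metis
  have "encodes m r (e(i := 0)) (u (lc ?L))"
    using u(2) encodes_enter[OF NAll.prems(3)] by auto
  from loop[OF u(1) this] show ?case
    by (simp only: fun_upd_upd fun_upd_same add_0 nform_holds.simps simp_thms)
qed

text \<open>The reals stored at the root, divided by the unit, provide the sets through their
  digits. The two inequalities of \<open>init_rule\<close> pin \<open>ereg 0\<close> to
  \<open>x\<close> units.\<close>

lemma Init_sound:
  assumes "(lc Init, v) \<in> W"
  shows "\<exists>X. nform_holds X ((\<lambda>_. 0)(0 := x)) \<phi>"
proof -
  obtain u where u: "\<forall>q'<nlocs \<phi>. (q', u q') \<in> W" "lform_holds v u (nform_rule m \<phi> x (lc Init))"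
    using W assms by (fastforce simp: consistent_def)
  have "(lc (Main \<phi>), u (lc (Main \<phi>))) \<in> W"
    using u(1) lc_less_nlocs[of "Main \<phi>" \<phi>] by simp
  moreover have "v 0 > 0" "v (ereg 0) = real x * v 0" "\<forall>i<m. i \<noteq> 0 \<longrightarrow> v (ereg i) = 0"
    and copy: "\<forall>q<nreg m. u (lc (Main \<phi>)) q = v q"
    using u(2) by (auto simp: nform_rule_def init_rule_def algebra_simps)
  then have "encodes m (\<lambda>j. v (sreg j) / v 0) ((\<lambda>_. 0)(0 := x)) v"
    by (simp add: encodes_def)
  then have "encodes m (\<lambda>j. v (sreg j) / v 0) ((\<lambda>_. 0)(0 := x)) (u (lc (Main \<phi>)))"
    using copy by (rule encodes_copy)
  ultimately show ?thesis
    using Main_sound by blast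
qed

end

section \<open>Completeness: a true formula yields a consistent set\<close>

text \<open>Only the digits 0 and 1 occur in base 3, so the digits behind a given place amount to at
  most half a unit of that place. Unlike in base 2, a digit can thus be decided by one
  comparison.\<close>

definition code3 :: "nat set \<Rightarrow> real" where
  "code3 Y = (\<Sum>n. indicator Y n * (1 / 3) ^ Suc n)"

lemma summable_code3: "summable (\<lambda>n. indicator Y n * (1 / 3 :: real) ^ Suc n)"
proof (rule summable_comparison_test')
  show "summable (\<lambda>n. (1 / 3 :: real) ^ Suc n)"
    by (subst summable_Suc_iff) (simp add: summable_geometric)
  show "norm (indicator Y n * (1 / 3 :: real) ^ Suc n) \<le> (1 / 3) ^ Suc n" for n
    by (simp add: indicator_def)
qed

lemma code3_nonneg: "0 \<le> code3 Y"
  unfolding code3_def by (intro suminf_nonneg summable_code3) auto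

lemma code3_le: "code3 Y \<le> 1 / 2"
proof -
  have "code3 Y \<le> (\<Sum>n. (1 / 3 :: real) ^ Suc n)"
    unfolding code3_def
    by (intro suminf_le summable_code3) (auto simp: indicator_def summable_geometric)
  also have "\<dots> = 1 / 2"
    using suminf_split_head[of "\<lambda>n. (1 / 3 :: real) ^ n"] by (simp add: suminf_geometric summable_geometric)
  finally show ?thesis .
qed

lemma code3_shift: "3 * code3 Y = indicator Y 0 + code3 {n. Suc n \<in> Y}"
proof -
  have "code3 Y = (\<Sum>n. indicator Y (Suc n) * (1 / 3) ^ Suc (Suc n)) + indicator Y 0 / 3"
    using suminf_split_head[OF summable_code3, of Y] by (simp add: code3_def)
  moreover have "(\<Sum>n. indicator Y (Suc n) * (1 / 3) ^ Suc (Suc n)) = code3 {n. Suc n \<in> Y} / 3"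
    unfolding code3_def by (subst suminf_divide[OF summable_code3, symmetric]) (simp add: indicator_def)
  ultimately show ?thesis by simp
qed

context
  fixes m x :: nat and \<phi> :: nform and X :: "nat \<Rightarrow> nat set"
  assumes ok: "nform_ok m \<phi>"
    and holds: "nform_holds X ((\<lambda>_. 0)(0 := x)) \<phi>"
begin

abbreviation (input) "rep \<equiv> encodes m (\<lambda>j. code3 (X j))"

text \<open>The denominator makes the unit so small that the input, stored as \<open>x\<close>
  units, fits into the unit interval.\<close>

definition start :: "nat \<Rightarrow> real" where
  "start r = (if r = 0 then 1 else if r = ereg 0 then real x
     else if r \<in> range sreg then code3 (X (inv sreg r)) else 0) / real (Suc x)"

text \<open>What a vector that is not idle asserts. In an existential loop \<open>n\<close> rounds
  remain before the witness, and the guess can still be doubled that often. In \<open>MemL\<close>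
  the set varies because it is shifted in every round.\<close>

fun claim :: "loc \<Rightarrow> (nat \<Rightarrow> real) \<Rightarrow> bool" where
  "claim (Main \<psi>) v \<longleftrightarrow> (\<exists>e. rep e v \<and> nform_holds X e \<psi>)"
| "claim (Loop (NEx i \<psi>)) v \<longleftrightarrow>
     (\<exists>e n. rep e v \<and> v 1 > 0 \<and> v 1 * 2 ^ n \<le> 1 \<and> nform_holds X (e(i := e i + n)) \<psi>)"
| "claim (Loop (NAll i \<psi>)) v \<longleftrightarrow> (\<exists>e. rep e v \<and> (\<forall>n. nform_holds X (e(i := e i + n)) \<psi>))"
| "claim MulL v \<longleftrightarrow> (\<exists>n. v 2 = real n * v 0 \<and> v 3 = real n * v 4)"
| "claim MemL v \<longleftrightarrow> (\<exists>n Y. v 2 = real n * v 0 \<and> v 3 = code3 Y * v 0 \<and> v 4 = (if n \<in> Y then v 0 else 0))"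
| "claim l v \<longleftrightarrow> True"

definition claims :: "(nat \<times> (nat \<Rightarrow> real)) set" where
  "claims = {(q, v). q < nlocs \<phi> \<and> (\<forall>r<nreg m. 0 \<le> v r \<and> v r \<le> 1) \<and>
     (if from_nat q = Init then v = start else v 0 = 0 \<or> claim (from_nat q) v)}"

definition idle :: "nat \<Rightarrow> nat \<Rightarrow> real" where
  "idle q = (if from_nat q = Init then start else (\<lambda>_. 0))"

lemma inj_sreg: "inj sreg"
  by (auto simp: inj_def sreg_def)

lemma start_simps: "start 0 = 1 / real (Suc x)" "start (ereg 0) = real x * start 0"
  "i \<noteq> 0 \<Longrightarrow> start (ereg i) = 0" "start (sreg j) = code3 (X j) * start 0"
  by (auto simp: start_def inj_sreg inv_f_f dest: sym)

lemma start_bounds: "0 \<le> start r" "start r \<le> 1"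
proof -
  have "0 \<le> code3 Y" "code3 Y \<le> 1 + real x" for Y
    using code3_nonneg[of Y] code3_le[of Y] by linarith+
  then show "0 \<le> start r" "start r \<le> 1"
    by (auto simp: start_def divide_simps)
qed

lemma rep_start: "rep ((\<lambda>_. 0)(0 := x)) start"
  by (auto simp: encodes_def start_simps)

lemma idle_claims: "q < nlocs \<phi> \<Longrightarrow> (q, idle q) \<in> claims"
  using start_bounds by (auto simp: claims_def idle_def)

lemma update_claims:
  assumes "\<And>q. q < nlocs \<phi> \<Longrightarrow> (q, u q) \<in> claims"
    and "l \<noteq> Init" "claim l w" "\<forall>r<nreg m. 0 \<le> w r \<and> w r \<le> 1" "q < nlocs \<phi>"
  shows "(q, (u(lc l := w)) q) \<in> claims"
  using assms start_bounds by (auto simp: claims_def)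

text \<open>A vector with a true claim can hand true claims on. At most two children have work to
  do; all others get \<open>idle\<close>.\<close>

lemma loc_rule_claims:
  assumes l: "l \<in> locs \<phi>" "l \<noteq> Init" and v: "claim l v" "v 0 > 0" and bnd: "\<forall>r<nreg m. 0 \<le> v r \<and> v r \<le> 1"
  shows "\<exists>u. (\<forall>q<nlocs \<phi>. (q, u q) \<in> claims) \<and> lform_holds v u (loc_rule (nreg m) l)"
proof -
  have regs: "0 < nreg m" "1 < nreg m" "2 < nreg m" "3 < nreg m" "4 < nreg m"
    by simp_all
  have b: "0 \<le> v 0" "v 0 \<le> 1" "0 \<le> v 2" "v 2 \<le> 1" "0 \<le> v 3" "v 3 \<le> 1" "0 \<le> v 4" "v 4 \<le> 1"
    using bnd regs by blast+
  have one: ?thesis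
    if "claim l' w" "\<forall>r<nreg m. 0 \<le> w r \<and> w r \<le> 1" "l' \<noteq> Init"
      "lform_holds v (idle(lc l' := w)) (loc_rule (nreg m) l)" for l' w
  proof (intro exI conjI allI impI)
    show "(q, (idle(lc l' := w)) q) \<in> claims" if "q < nlocs \<phi>" for q
      by (rule update_claims) (fact idle_claims that \<open>claim l' w\<close> \<open>l' \<noteq> Init\<close> \<open>\<forall>r<nreg m. 0 \<le> w r \<and> w r \<le> 1\<close>)+
  qed (rule that)
  have two: ?thesis
    if "claim l' w" "\<forall>r<nreg m. 0 \<le> w r \<and> w r \<le> 1" "l' \<noteq> Init"
      "claim l'' w'" "\<forall>r<nreg m. 0 \<le> w' r \<and> w' r \<le> 1" "l'' \<noteq> Init"
      "lform_holds v (idle(lc l' := w, lc l'' := w')) (loc_rule (nreg m) l)" for l' w l'' w'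
  proof (intro exI conjI allI impI)
    show "(q, (idle(lc l' := w, lc l'' := w')) q) \<in> claims" if "q < nlocs \<phi>" for q
    proof (rule update_claims)
      show "(q, (idle(lc l' := w)) q) \<in> claims" if "q < nlocs \<phi>" for q
        by (rule update_claims) (fact idle_claims that \<open>claim l' w\<close> \<open>l' \<noteq> Init\<close> \<open>\<forall>r<nreg m. 0 \<le> w r \<and> w r \<le> 1\<close>)+
    qed (fact that \<open>claim l'' w'\<close> \<open>l'' \<noteq> Init\<close> \<open>\<forall>r<nreg m. 0 \<le> w' r \<and> w' r \<le> 1\<close>)+
  qed (rule that)
  \<comment> \<open>The vector of the next round of a loop, with \<open>p\<close> as the new content
    of register 1.\<close>
  define half where "half i p = (\<lambda>r. if r = 1 then p else if r = ereg i then (v r + v 0) / 2 else v r / 2)" for i p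
  have half_bnd: "\<forall>r<nreg m. 0 \<le> half i p r \<and> half i p r \<le> 1" if "i < m" "0 \<le> p" "p \<le> 1" for i p
  proof -
    have "0 \<le> v (ereg i)" "v (ereg i) \<le> 1"
      using bnd that(1) by simp_all
    then have "0 \<le> v (ereg i) + v 0" "v (ereg i) + v 0 \<le> 2"
      using b(1,2) by linarith+
    moreover have "v r / 2 \<le> 1" if "r < nreg m" for r
      using bnd[rule_format, OF that] by simp
    ultimately show ?thesis
      using that bnd b(1,2) unfolding half_def by auto
  qed
  have half_rep: "rep (e(i := Suc (e i))) (half i p)" if "rep e v" for e i p
    using that by (rule encodes_step) (auto simp: half_def)
  show ?thesis
  proof (cases l)
    case (Main \<psi>)
    with l have "\<psi> \<in> subs \<phi>" by simp
    then have \<psi>: "nform_ok m \<psi>"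
      by (rule nform_ok_subs[OF ok])
    obtain e where e: "rep e v" "nform_holds X e \<psi>"
      using v Main by auto
    show ?thesis
    proof (cases \<psi>)
      case (NLin ts c)
      then show ?thesis
        using idle_claims encodes_NLin[OF e(1)] e(2) \<psi> Main by blast
    next
      case (NMul i j k)
      define w where "w = (\<lambda>r::nat. 0::real)(0 := v 0, 2 := v (ereg i), 3 := v (ereg k), 4 := v (ereg j))"
      have eq: "v (ereg i) = real (e i) * v 0" "v (ereg k) = real (e i) * v (ereg j)"
        using e \<psi> NMul by (auto simp: encodes_def simp flip: of_nat_mult)
      have "claim MulL w"
        using eq by (auto simp: w_def)
      moreover have "\<forall>r<nreg m. 0 \<le> w r \<and> w r \<le> 1"
        using bnd \<psi> NMul b by (auto simp: w_def)
      ultimately show ?thesis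
        by (intro one[of "MulL" w]) (assumption | auto simp: Main NMul w_def)+
    next
      case (NMem t i j)
      define w where "w = (\<lambda>r::nat. 0::real)(0 := v 0, 2 := v (ereg i), 3 := v (sreg j),
        4 := (if t then v 0 else 0))"
      have eq: "v (ereg i) = real (e i) * v 0" "v (sreg j) = code3 (X j) * v 0" "(e i \<in> X j) = t"
        using e \<psi> NMem by (auto simp: encodes_def)
      have "claim MemL w"
        using eq by (auto simp: w_def intro!: exI[of _ "e i"] exI[of _ "X j"])
      moreover have "\<forall>r<nreg m. 0 \<le> w r \<and> w r \<le> 1"
        using bnd \<psi> NMem b by (auto simp: w_def)
      ultimately show ?thesis
        by (intro one[of "MemL" w]) (assumption | auto simp: Main NMem w_def)+
    next
      case (NAnd \<psi>1 \<psi>2)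
      then have "claim (Main \<psi>1) v" "claim (Main \<psi>2) v"
        using e by auto
      then show ?thesis
        using bnd by (intro two[of "Main \<psi>1" v "Main \<psi>2" v]) (assumption | simp add: Main NAnd)+
    next
      case (NOr \<psi>1 \<psi>2)
      then have "claim (Main \<psi>1) v \<or> claim (Main \<psi>2) v"
        using e by auto
      then show ?thesis
      proof
        assume "claim (Main \<psi>1) v"
        then show ?thesis
          using bnd by (intro one[of "Main \<psi>1" v]) (assumption | simp add: Main NOr)+
      next
        assume "claim (Main \<psi>2) v"
        then show ?thesis
          using bnd by (intro one[of "Main \<psi>2" v]) (assumption | simp add: Main NOr)+
      qed
    next
      case (NEx i \<theta>)
      then obtain n where n: "nform_holds X (e(i := n)) \<theta>"
        using e by auto
      \<comment> \<open>This guess reaches 1 after \<open>n\<close> doublings, which allows exactly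
        the \<open>n\<close> rounds up to the witness.\<close>
      define w where "w = v(ereg i := 0, 1 := 1 / 2 ^ n)"
      have "rep (e(i := 0)) w"
        using e(1) by (rule encodes_enter) (auto simp: w_def)
      then have "claim (Loop (NEx i \<theta>)) w"
        using n by (auto simp: w_def intro!: exI[of _ "e(i := 0)"] exI[of _ n])
      moreover have "\<forall>r<nreg m. 0 \<le> w r \<and> w r \<le> 1"
        using bnd by (auto simp: w_def)
      ultimately show ?thesis
        by (intro one[of "(Loop (NEx i \<theta>))" w]) (assumption | auto simp: Main NEx w_def)+
    next
      case (NAll i \<theta>)
      define w where "w = v(ereg i := 0)"
      have "rep (e(i := 0)) w"
        using e(1) by (rule encodes_enter) (auto simp: w_def)
      then have "claim (Loop (NAll i \<theta>)) w"
        using e(2) NAll by (auto simp: w_def intro!: exI[of _ "e(i := 0)"])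
      moreover have "\<forall>r<nreg m. 0 \<le> w r \<and> w r \<le> 1"
        using bnd by (auto simp: w_def)
      ultimately show ?thesis
        by (intro one[of "(Loop (NAll i \<theta>))" w]) (assumption | auto simp: Main NAll w_def)+
    qed
  next
    case (Loop \<psi>)
    with l have "\<psi> \<in> subs \<phi>" by simp
    then have \<psi>: "nform_ok m \<psi>"
      by (rule nform_ok_subs[OF ok])
    consider i \<theta> where "\<psi> = NEx i \<theta>" | i \<theta> where "\<psi> = NAll i \<theta>" | "loc_rule (nreg m) l = ltrue"
      using Loop by (cases \<psi>) auto
    then show ?thesis
    proof cases
      case 1
      then obtain e n where e: "rep e v" "v 1 > 0" "v 1 * 2 ^ n \<le> 1" "nform_holds X (e(i := e i + n)) \<theta>"
        using v Loop by auto
      show ?thesis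
      proof (cases n)
        case 0
        then have "claim (Main \<theta>) v"
          using e by auto
        then show ?thesis
          using bnd by (intro one[of "Main \<theta>" v]) (assumption | simp add: Loop 1)+
      next
        case (Suc n')
        let ?w = "half i (2 * v 1)"
        \<comment> \<open>At least one doubling is still to come, so the next guess is again a
          probability.\<close>
        have "1 \<le> (2::real) ^ n'" by simp
        then have p: "2 * v 1 \<le> 1"
          using e(2,3) mult_left_mono[of 1 "2 ^ n'" "2 * v 1"] unfolding Suc power_Suc by linarith
        have "claim (Loop (NEx i \<theta>)) ?w"
          using e Suc half_rep[OF e(1), of i "2 * v 1"]
          by (auto simp: half_def intro!: exI[of _ "e(i := Suc (e i))"] exI[of _ n'])
        moreover have "\<forall>r<nreg m. 0 \<le> ?w r \<and> ?w r \<le> 1"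
          using half_bnd[of i "2 * v 1"] p e(2) \<psi> 1 by simp
        ultimately show ?thesis
          by (intro one[of "Loop (NEx i \<theta>)" ?w]) (assumption | simp add: Loop 1 half_def)+
      qed
    next
      case 2
      then obtain e where e: "rep e v" "\<And>n. nform_holds X (e(i := e i + n)) \<theta>"
        using v Loop by auto
      let ?w = "half i 0"
      have "claim (Main \<theta>) v"
        using e(1) e(2)[of 0] by auto
      moreover have "claim (Loop (NAll i \<theta>)) ?w"
        using e(2)[of "Suc n" for n] half_rep[OF e(1), of i 0]
        by (auto intro!: exI[of _ "e(i := Suc (e i))"])
      moreover have "\<forall>r<nreg m. 0 \<le> ?w r \<and> ?w r \<le> 1"
        using half_bnd[of i 0] \<psi> 2 by simp
      ultimately show ?thesis
        using bnd by (intro two[of "Main \<theta>" v "Loop (NAll i \<theta>)" ?w])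
          (assumption | simp add: Loop 2 half_def)+
    next
      case 3
      then show ?thesis using idle_claims by auto
    qed
  next
    case MulL
    then obtain n where n: "v 2 = real n * v 0" "v 3 = real n * v 4"
      using v by auto
    show ?thesis
    proof (cases n)
      case 0
      then show ?thesis using n idle_claims by (auto simp: MulL)
    next
      case (Suc n')
      \<comment> \<open>With a round left, registers 2 and 3 are at least the amounts subtracted, so
        the entries stay in the unit interval.\<close>
      define w where "w = v(2 := v 2 - v 0, 3 := v 3 - v 4)"
      have w: "w 2 = real n' * v 0" "w 3 = real n' * v 4"
        using n Suc by (auto simp: w_def algebra_simps)
      then have "claim MulL w"
        by (auto simp: w_def)
      moreover have "0 \<le> w 2" "0 \<le> w 3" "w 2 \<le> 1" "w 3 \<le> 1"
        using w b by (simp_all add: w_def)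
      then have "\<forall>r<nreg m. 0 \<le> w r \<and> w r \<le> 1"
        using bnd by (auto simp: w_def)
      ultimately show ?thesis
        by (intro one[of "MulL" w]) (assumption | auto simp: MulL w_def)+
    qed
  next
    case MemL
    then obtain n Y where n: "v 2 = real n * v 0" "v 3 = code3 Y * v 0" "v 4 = (if n \<in> Y then v 0 else 0)"
      using v by auto
    let ?Y = "{n. Suc n \<in> Y}"
    have v3: "3 * v 3 = indicator Y 0 * v 0 + code3 ?Y * v 0"
      using n(2) by (simp flip: code3_shift distrib_right)
    \<comment> \<open>The remaining digits amount to less than a unit, so comparing
      \<open>3 * v 3\<close> with the unit decides the first digit.\<close>
    have small: "0 \<le> code3 ?Y * v 0" "code3 ?Y * v 0 < v 0"
      using code3_nonneg[of ?Y] code3_le[of ?Y] v(2) by auto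
    then have small': "code3 ?Y * v 0 \<le> 1"
      using b(2) by linarith
    have digit: "3 * v 3 \<ge> v 0 \<longleftrightarrow> 0 \<in> Y"
    proof (cases "0 \<in> Y")
      case True
      then have "3 * v 3 = v 0 + code3 ?Y * v 0" using v3 by simp
      with small True show ?thesis by linarith
    next
      case False
      then have "3 * v 3 = code3 ?Y * v 0" using v3 by simp
      with small False show ?thesis by linarith
    qed
    show ?thesis
    proof (cases n)
      case 0
      then show ?thesis
        using n idle_claims digit by (intro exI[of _ idle]) (auto simp: MemL)
    next
      case (Suc n')
      define w where "w = v(2 := v 2 - v 0, 3 := code3 ?Y * v 0)"
      have w: "w 2 = real n' * v 0"
        using n Suc by (auto simp: w_def algebra_simps)
      then have "claim MemL w"
        using n Suc by (auto simp: w_def intro!: exI[of _ n'] exI[of _ ?Y])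
      moreover have "0 \<le> w 2" "w 2 \<le> 1"
        using w b by (simp_all add: w_def)
      then have "\<forall>r<nreg m. 0 \<le> w r \<and> w r \<le> 1"
        using bnd small(1) small' by (auto simp: w_def)
      moreover have "w 3 = (if 3 * v 3 \<ge> v 0 then 3 * v 3 - v 0 else 3 * v 3)"
        using v3 digit by (auto simp: w_def)
      ultimately show ?thesis
        by (intro one[of "MemL" w]) (assumption | auto simp: MemL w_def split: if_splits)+
    qed
  qed (use l in auto)
qed

lemma consistent_claims: "consistent (nlocs \<phi>) (nreg m) (nform_rule m \<phi> x) claims"
  unfolding consistent_def
proof (clarify, intro conjI allI impI)
  fix q v assume qv: "(q, v) \<in> claims"
  let ?l = "from_nat q :: loc"
  show "0 \<le> v r" "v r \<le> 1" if "r < nreg m" for r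
    using qv that by (auto simp: claims_def)
  show "q < nlocs \<phi>"
    using qv by (auto simp: claims_def)
  consider "?l = Init" | "?l \<noteq> Init" "?l \<notin> locs \<phi> \<or> v 0 = 0" | "?l \<noteq> Init" "?l \<in> locs \<phi>" "v 0 \<noteq> 0"
    by blast
  then show "\<exists>u. (\<forall>q'<nlocs \<phi>. (q', u q') \<in> claims) \<and> lform_holds v u (nform_rule m \<phi> x q)"
  proof cases
    case 1
    then have "v = start"
      using qv by (simp add: claims_def)
    let ?u = "idle(lc (Main \<phi>) := start)"
    have "claim (Main \<phi>) start"
      using rep_start holds by auto
    then have "(q', ?u q') \<in> claims" if "q' < nlocs \<phi>" for q'
      using idle_claims that start_bounds by (intro update_claims) auto
    moreover have "lform_holds v ?u (nform_rule m \<phi> x q)"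
      using 1 \<open>v = start\<close> start_simps
      by (auto simp: nform_rule_def init_rule_def algebra_simps)
    ultimately show ?thesis by blast
  next
    case 2
    then show ?thesis
      using idle_claims by (intro exI[of _ idle]) (auto simp: nform_rule_def Let_def)
  next
    case 3
    then have "claim ?l v" and bnd: "\<forall>r<nreg m. 0 \<le> v r \<and> v r \<le> 1"
      using qv by (auto simp: claims_def)
    moreover have "v 0 > 0"
      using bnd 3(3) by (metis less_eq_real_def reg_simps(9))
    ultimately show ?thesis
      using loc_rule_claims[OF 3(2,1)] 3 by (auto simp: nform_rule_def)
  qed
qed

lemma start_claims: "(lc Init, start) \<in> claims"
  using start_bounds by (auto simp: claims_def lc_less_nlocs)

end

lemma nform_rule_consistent_iff:
  assumes "nform_ok m \<phi>"
  shows "(\<exists>W v. consistent (nlocs \<phi>) (nreg m) (nform_rule m \<phi> x) W \<and> (lc Init, v) \<in> W) \<longleftrightarrow>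
    (\<exists>X. nform_holds X ((\<lambda>_. 0)(0 := x)) \<phi>)"
proof
  assume "\<exists>W v. consistent (nlocs \<phi>) (nreg m) (nform_rule m \<phi> x) W \<and> (lc Init, v) \<in> W"
  then show "\<exists>X. nform_holds X ((\<lambda>_. 0)(0 := x)) \<phi>"
    using Init_sound[OF assms] by blast
next
  assume "\<exists>X. nform_holds X ((\<lambda>_. 0)(0 := x)) \<phi>"
  then obtain X where X: "nform_holds X ((\<lambda>_. 0)(0 := x)) \<phi>" ..
  show "\<exists>W v. consistent (nlocs \<phi>) (nreg m) (nform_rule m \<phi> x) W \<and> (lc Init, v) \<in> W"
    using consistent_claims[OF assms X] start_claims[OF assms X] by blast
qed

section \<open>The reduction\<close>

primrec aterm_bound :: "aterm \<Rightarrow> nat" where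
  "aterm_bound (AVar i) = Suc i"
| "aterm_bound AZero = 0"
| "aterm_bound (ASuc t) = aterm_bound t"
| "aterm_bound (AAdd t u) = max (aterm_bound t) (aterm_bound u)"
| "aterm_bound (AMul t u) = max (aterm_bound t) (aterm_bound u)"

primrec aform_bound :: "aform \<Rightarrow> nat" where
  "aform_bound (AEq t u) = max (aterm_bound t) (aterm_bound u)"
| "aform_bound (AMem t j) = aterm_bound t"
| "aform_bound (ANot \<phi>) = aform_bound \<phi>"
| "aform_bound (AAnd \<phi> \<psi>) = max (aform_bound \<phi>) (aform_bound \<psi>)"
| "aform_bound (AEx i \<phi>) = max (Suc i) (aform_bound \<phi>)"

lemma aterm_val_upd [simp]: "aterm_bound t \<le> a \<Longrightarrow> aterm_val (e(a := n)) t = aterm_val e t"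
  by (induction t) auto

definition nzero :: "(int \<times> nat) list \<Rightarrow> int \<Rightarrow> nform" where
  "nzero ts c = NAnd (NLin ts c) (NLin (map (\<lambda>(a, i). (- a, i)) ts) (- c))"

lemma nform_holds_nzero [simp]:
  "nform_holds X e (nzero ts c) \<longleftrightarrow> c + (\<Sum>(a, i)\<leftarrow>ts. a * int (e i)) = 0"
proof -
  have "(\<Sum>(a, i)\<leftarrow>map (\<lambda>(a, i). (- a, i)) ts. a * int (e i)) = - (\<Sum>(a, i)\<leftarrow>ts. a * int (e i))"
    by (induction ts) auto
  then show ?thesis by (simp add: nzero_def) linarith
qed

text \<open>\<open>NMul\<close> multiplies variables only, so each immediate subterm gets a variable
  of its own. These lie above \<open>a\<close> and are fresh once the variables of the term lie
  below \<open>a\<close>.\<close>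

primrec aterm_nform :: "aterm \<Rightarrow> nat \<Rightarrow> nform" where
  "aterm_nform (AVar i) a = nzero [(1, a), (-1, i)] 0"
| "aterm_nform AZero a = nzero [(1, a)] 0"
| "aterm_nform (ASuc t) a =
     NEx (Suc a) (NAnd (aterm_nform t (Suc a)) (nzero [(1, a), (-1, Suc a)] (-1)))"
| "aterm_nform (AAdd t u) a =
     NEx (Suc a) (NAnd (aterm_nform t (Suc a)) (NEx (Suc (Suc a)) (NAnd (aterm_nform u (Suc (Suc a)))
       (nzero [(1, a), (-1, Suc a), (-1, Suc (Suc a))] 0))))"
| "aterm_nform (AMul t u) a =
     NEx (Suc a) (NAnd (aterm_nform t (Suc a)) (NEx (Suc (Suc a)) (NAnd (aterm_nform u (Suc (Suc a)))
       (NMul (Suc a) (Suc (Suc a)) a))))"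

lemma nform_holds_aterm_nform:
  "aterm_bound t \<le> a \<Longrightarrow> nform_holds X e (aterm_nform t a) \<longleftrightarrow> e a = aterm_val e t"
  by (induction t arbitrary: a e) auto

text \<open>The polarity \<open>b\<close> pushes negations to the atoms; a refuted equation becomes
  a choice between two integer inequalities with a gap of 1. Auxiliary variables are quantified on
  the spot, so the same \<open>a\<close> serves all subformulas.\<close>

primrec aform_nform :: "nat \<Rightarrow> bool \<Rightarrow> aform \<Rightarrow> nform" where
  "aform_nform a b (AEq t u) =
     NEx a (NAnd (aterm_nform t a) (NEx (Suc a) (NAnd (aterm_nform u (Suc a))
       (if b then nzero [(1, a), (-1, Suc a)] 0
        else NOr (NLin [(1, a), (-1, Suc a)] (-1)) (NLin [(-1, a), (1, Suc a)] (-1))))))"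
| "aform_nform a b (AMem t j) = NEx a (NAnd (aterm_nform t a) (NMem b a j))"
| "aform_nform a b (ANot \<phi>) = aform_nform a (\<not> b) \<phi>"
| "aform_nform a b (AAnd \<phi> \<psi>) =
     (if b then NAnd (aform_nform a b \<phi>) (aform_nform a b \<psi>) else NOr (aform_nform a b \<phi>) (aform_nform a b \<psi>))"
| "aform_nform a b (AEx i \<phi>) = (if b then NEx i (aform_nform a b \<phi>) else NAll i (aform_nform a b \<phi>))"

lemma nform_holds_aform_nform:
  "aform_bound \<phi> \<le> a \<Longrightarrow> nform_holds X e (aform_nform a b \<phi>) \<longleftrightarrow> aform_holds X e \<phi> = b"
  by (induction \<phi> arbitrary: b e) (auto simp: nform_holds_aterm_nform)

section \<open>Recursiveness of the reduction\<close>

lemma total_recursive_const: "total_recursive (\<lambda>_. c)"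
proof (induction c)
  case 0
  show ?case unfolding total_recursive_def by (blast intro: rec_eval.zero)
next
  case (Suc c)
  then obtain r where "\<And>x. rec_eval r [x] c" by (auto simp: total_recursive_def)
  then have "rec_eval (Comp Succ [r]) [x] (Suc c)" for x
    by (intro rec_eval.comp[where ys="[c]"] rec_eval.succ) auto
  then show ?case unfolding total_recursive_def by blast
qed

lemma total_recursive_id: "total_recursive (\<lambda>x. x)"
  unfolding total_recursive_def using rec_eval.proj[of 0 "[x]" for x] by auto

lemma total_recursive_comp1:
  assumes "\<And>a. rec_eval g [a] (G a)" "total_recursive f"
  shows "total_recursive (\<lambda>x. G (f x))"
proof -
  obtain r where r: "\<And>x. rec_eval r [x] (f x)"
    using assms(2) by (auto simp: total_recursive_def)
  have "rec_eval (Comp g [r]) [x] (G (f x))" for x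
    by (rule rec_eval.comp[where ys="[f x]"]) (use r assms(1) in auto)
  then show ?thesis unfolding total_recursive_def by blast
qed

lemma total_recursive_comp2:
  assumes "\<And>a b. rec_eval g [a, b] (G a b)" "total_recursive f" "total_recursive h"
  shows "total_recursive (\<lambda>x. G (f x) (h x))"
proof -
  obtain r s where rs: "\<And>x. rec_eval r [x] (f x)" "\<And>x. rec_eval s [x] (h x)"
    using assms(2,3) by (auto simp: total_recursive_def)
  have "rec_eval (Comp g [r, s]) [x] (G (f x) (h x))" for x
    by (rule rec_eval.comp[where ys="[f x, h x]"]) (use rs assms(1) in auto)
  then show ?thesis unfolding total_recursive_def by blast
qed

lemma total_recursive_Suc: "total_recursive f \<Longrightarrow> total_recursive (\<lambda>x. Suc (f x))"
  by (rule total_recursive_comp1[OF rec_eval.succ])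

text \<open>Codes of formulas are built by pairing and successor, and \<open>prod_encode\<close> is
  a triangular number plus its first argument. Addition and \<open>triangle\<close> are thus the
  only functions to be programmed.\<close>

definition rec_add :: recf where
  "rec_add = PrimRec (Proj 0) (Comp Succ [Proj 1])"

lemma rec_eval_add: "rec_eval rec_add [a, b] (a + b)"
proof (induction a)
  case 0
  show ?case
    unfolding rec_add_def using rec_eval.primrec_0[OF rec_eval.proj[of 0 "[b]"]] by simp
next
  case (Suc a)
  have "rec_eval (Comp Succ [Proj 1]) [a, a + b, b] (Suc (a + b))"
    using rec_eval.proj[of 1 "[a, a + b, b]"] by (intro rec_eval.comp[where ys="[a + b]"] rec_eval.succ) auto
  with Suc show ?case
    unfolding rec_add_def by (auto intro: rec_eval.primrec_Suc)
qed

definition rec_triangle :: recf where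
  "rec_triangle = PrimRec Zero (Comp Succ [Comp rec_add [Proj 0, Proj 1]])"

lemma rec_eval_triangle: "rec_eval rec_triangle [n] (triangle n)"
proof (induction n)
  case 0
  show ?case
    unfolding rec_triangle_def using rec_eval.primrec_0[OF rec_eval.zero] by simp
next
  case (Suc n)
  let ?xs = "[n, triangle n]"
  have "rec_eval (Comp rec_add [Proj 0, Proj 1]) ?xs (n + triangle n)"
    using rec_eval.proj[of 0 ?xs] rec_eval.proj[of 1 ?xs]
    by (intro rec_eval.comp[where ys="?xs"] rec_eval_add) auto
  then have "rec_eval (Comp Succ [Comp rec_add [Proj 0, Proj 1]]) ?xs (Suc (n + triangle n))"
    by (intro rec_eval.comp[where ys="[n + triangle n]"] rec_eval.succ) auto
  with Suc show ?case
    unfolding rec_triangle_def by (auto intro: rec_eval.primrec_Suc simp: add.commute)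
qed

lemma total_recursive_prod_encode:
  assumes "total_recursive f" "total_recursive g"
  shows "total_recursive (\<lambda>x. prod_encode (f x, g x))"
proof -
  note add = total_recursive_comp2[OF rec_eval_add]
  show ?thesis
    unfolding prod_encode_def prod.case
    by (intro add total_recursive_comp1[OF rec_eval_triangle] assms)
qed

lemma total_recursive_int_encode:
  "total_recursive (\<lambda>x. int_encode (int x))" "total_recursive (\<lambda>x. int_encode (- 1 - int x))"
proof -
  have "total_recursive (\<lambda>x. x + x)"
    by (intro total_recursive_comp2[OF rec_eval_add] total_recursive_id)
  moreover have "int_encode (int x) = x + x" "int_encode (- 1 - int x) = Suc (x + x)" for x
    by (simp_all add: int_encode_def sum_encode_def)
  ultimately show "total_recursive (\<lambda>x. int_encode (int x))" "total_recursive (\<lambda>x. int_encode (- 1 - int x))"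
    using total_recursive_Suc by simp_all
qed

lemmas total_recursive_intros = total_recursive_const total_recursive_Suc
  total_recursive_prod_encode total_recursive_int_encode

lemma total_recursive_foldr_Conj:
  assumes "\<And>q. total_recursive (\<lambda>x. encode_sform (F x q))"
  shows "total_recursive (\<lambda>x. encode_sform (foldr Conj (map (F x) qs) b))"
  by (induction qs) (auto intro!: total_recursive_intros assms)

text \<open>Only the rule at \<open>Init\<close> depends on \<open>x\<close>, through two
  coefficients of \<open>Cur 0\<close>. Coefficients of \<open>Cur\<close> terms are not rescaled by
  \<open>lform_sform\<close>, so \<open>total_recursive_int_encode\<close> covers both.\<close>

lemma total_recursive_gform:
  "total_recursive (\<lambda>x. encode_sform (gform Q k (nform_rule m \<phi> x)))"
proof -
  have "total_recursive (\<lambda>x. encode_sform (lform_sform Q k q (nform_rule m \<phi> x q)))" for q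
    by (cases "from_nat q = Init")
      (auto simp: nform_rule_def init_rule_def intro!: total_recursive_intros)
  then show ?thesis
    unfolding gform_def
    by (intro total_recursive_foldr_Conj) (auto intro!: total_recursive_intros)
qed

theorem theorem36:
  shows "sigma11_hard flat_global_window_synthesis"
  unfolding sigma11_hard_def
proof (intro allI impI)
  fix A assume "sigma11 A"
  then obtain \<phi> where \<phi>: "\<And>x. x \<in> A \<longleftrightarrow> (\<exists>X. aform_holds X ((\<lambda>_. 0)(0 := x)) \<phi>)"
    by (auto simp: sigma11_def)
  define \<psi> where "\<psi> = aform_nform (aform_bound \<phi>) True \<phi>"
  obtain m where m: "m > 0" "nform_ok m \<psi>"
    using ex_nform_ok by blast
  define f where "f x = encode_instance (gmdp (nlocs \<psi>) (nreg m) (lc Init))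
    (gform (nlocs \<psi>) (nreg m) (nform_rule m \<psi> x))" for x
  \<comment> \<open>The MDP does not depend on \<open>x\<close>, so its code is a constant.\<close>
  have "total_recursive f"
    unfolding f_def encode_instance_def
    by (intro total_recursive_intros total_recursive_gform)
  moreover have "x \<in> A \<longleftrightarrow> f x \<in> flat_global_window_synthesis" for x
  proof -
    have "x \<in> A \<longleftrightarrow> (\<exists>X. nform_holds X ((\<lambda>_. 0)(0 := x)) \<psi>)"
      by (simp add: \<phi> \<psi>_def nform_holds_aform_nform)
    also have "\<dots> \<longleftrightarrow> (\<exists>W v. consistent (nlocs \<psi>) (nreg m) (nform_rule m \<psi> x) W \<and> (lc Init, v) \<in> W)"
      by (rule nform_rule_consistent_iff[OF m(2), symmetric])
    also have "\<dots> \<longleftrightarrow> f x \<in> flat_global_window_synthesis"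
      unfolding f_def using m
      by (intro gmdp_synthesis_iff[symmetric] lform_ok_nform_rule lc_less_nlocs) simp_all
    finally show ?thesis .
  qed
  ultimately show "many_one_reducible A flat_global_window_synthesis"
    unfolding many_one_reducible_def by blast
qed

end
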